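(* Let $(M,d)$ be a countable proper metric space with base point $0$. Then $$\mathrm{Lip}_0(M)^*=\mathcal{F}(M)\oplus_1\left(\bigoplus_{x\in M'}\mathcal{D}(x)\right)_1\oplus_1\Lambda_\infty(M),$$ where $\mathcal{D}(x)$ is the space of all derivations at $x$, $M'$ is the derived set of $M$, $\Lambda_\infty(M)$ is the space of functionals concentrated at infinity, and all direct sums denote $\ell_1$-sums.
   Context: $\mathrm{Lip}_0(M)$ is the Banach space of real-valued Lipschitz functions $f$ on $M$ with $f(0)=0$, normed by the optimal Lipschitz constant. For $x\in M$, $\delta(x)\in\mathrm{Lip}_0(M)^*$ is evaluation at $x$, and $\mathcal{F}(M)=\overline{\mathrm{span}}\,\delta(M)\subset\mathrm{Lip}_0(M)^*$ is the Lipschitz-free space. $M$ is proper if its closed balls are compact (so $M$ is complete). The derived set $M'$ is the set of accumulation points of $M$. $\phi\in\mathrm{Lip}_0(M)^*$ is a derivation at $x\in M$ if $\langle f,\phi\rangle=0$ for every $f\in\mathrm{Lip}_0(M)$ that is constant in a neighbourhood of $x$. With $\rho(x)=d(x,0)$ and $n\in\mathbb{Z}$, let $h_n:M\to\mathbb{R}$ be $h_n(x)=1$ if $\rho(x)\leq 2^n$, $h_n(x)=2-2^{-n}\rho(x)$ if $2^n\leq\rho(x)\leq 2^{n+1}$, $h_n(x)=0$ if $\rho(x)\geq 2^{n+1}$; $W_{h_n}(f)=f\cdot h_n$ is a bounded operator on $\mathrm{Lip}_0(M)$. $\phi$ is concentrated at infinity if $W_{h_n}^*(\phi)=0$ for all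 $n$ (equivalently, $\langle f,\phi\rangle=0$ for all $f\in\mathrm{Lip}_0(M)$ with bounded support). The displayed equality is an internal decomposition into closed subspaces of $\mathrm{Lip}_0(M)^*$: every $\phi$ is uniquely a norm-convergent sum of elements of the listed subspaces, and $\|\phi\|$ is the sum of the norms of these components. *)

theory Defs
  imports "HOL-Analysis.Analysis"
begin

class pointed_metric_space = metric_space +
  fixes basepoint :: 'a

lemma lipschitz_on_Inf:
  fixes f :: "'a::metric_space \<Rightarrow> 'b::metric_space"
  assumes "L-lipschitz_on S f"
  shows "(Inf {K. K-lipschitz_on S f})-lipschitz_on S f"
proof (rule lipschitz_onI)
  let ?A = "{K. K-lipschitz_on S f}"
  have ne: "?A \<noteq> {}" using assms by auto
  show "0 \<le> Inf ?A"
    using ne by (intro cInf_greatest) (auto dest: lipschitz_on_nonneg)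
  fix x y assume xy: "x \<in> S" "y \<in> S"
  show "dist (f x) (f y) \<le> Inf ?A * dist x y"
  proof (cases "x = y")
    case False
    then have "dist (f x) (f y) / dist x y \<le> Inf ?A"
      using ne xy by (intro cInf_greatest) (auto simp: divide_le_eq dest: lipschitz_onD)
    then show ?thesis using False by (simp add: divide_le_eq)
  qed simp
qed

lemma Inf_lipschitz_le:
  fixes f :: "'a::metric_space \<Rightarrow> 'b::metric_space"
  assumes "L-lipschitz_on S f"
  shows "Inf {K. K-lipschitz_on S f} \<le> L"
  using assms by (intro cInf_lower bdd_belowI[of _ 0]) (auto dest: lipschitz_on_nonneg)

typedef (overloaded) 'a lip0 =
  "{f :: 'a::pointed_metric_space \<Rightarrow> real. f basepoint = 0 \<and> (\<exists>L. L-lipschitz_on UNIV f)}"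
  morphisms lip0_apply Abs_lip0
  by (rule exI[of _ "\<lambda>_. 0"]) (auto intro: lipschitz_intros)

declare [[coercion lip0_apply]]

setup_lifting type_definition_lip0

lemma lip0_eqI: "(\<And>x. lip0_apply f x = lip0_apply g x) \<Longrightarrow> f = g"
  by transfer auto

lemma lip0_basepoint [simp]: "lip0_apply f basepoint = 0"
  by transfer simp

lemma lipschitz_scaleR:
  fixes f :: "'a::metric_space \<Rightarrow> real"
  assumes "L-lipschitz_on S f"
  shows "(\<bar>c\<bar> * L)-lipschitz_on S (\<lambda>x. c *\<^sub>R f x)"
  using lipschitz_on_cmult_real[OF assms, of c] by simp

instantiation lip0 :: (pointed_metric_space) real_normed_vector
begin

lift_definition norm_lip0 :: "'a lip0 \<Rightarrow> real"
  is "\<lambda>f. Inf {L. L-lipschitz_on UNIV f}" .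

lift_definition zero_lip0 :: "'a lip0" is "\<lambda>_. 0"
  by (auto intro: lipschitz_intros)

lift_definition plus_lip0 :: "'a lip0 \<Rightarrow> 'a lip0 \<Rightarrow> 'a lip0" is "\<lambda>f g x. f x + g x"
  by (auto intro: lipschitz_on_add)

lift_definition minus_lip0 :: "'a lip0 \<Rightarrow> 'a lip0 \<Rightarrow> 'a lip0" is "\<lambda>f g x. f x - g x"
  by (auto intro: lipschitz_on_diff)

lift_definition uminus_lip0 :: "'a lip0 \<Rightarrow> 'a lip0" is "\<lambda>f x. - f x"
  by (auto intro: lipschitz_on_minus)

lift_definition scaleR_lip0 :: "real \<Rightarrow> 'a lip0 \<Rightarrow> 'a lip0" is "\<lambda>c f x. c *\<^sub>R f x"
  using lipschitz_scaleR by auto blast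

definition dist_lip0 :: "'a lip0 \<Rightarrow> 'a lip0 \<Rightarrow> real"
  where "dist_lip0 f g = norm (f - g)"

definition uniformity_lip0 :: "('a lip0 \<times> 'a lip0) filter"
  where "uniformity_lip0 = (INF e\<in>{0 <..}. principal {(x, y). dist x y < e})"

definition open_lip0 :: "'a lip0 set \<Rightarrow> bool"
  where "open_lip0 S = (\<forall>x\<in>S. \<forall>\<^sub>F (x', y) in uniformity. x' = x \<longrightarrow> y \<in> S)"

definition sgn_lip0 :: "'a lip0 \<Rightarrow> 'a lip0"
  where "sgn_lip0 f = scaleR (inverse (norm f)) f"

instance
proof
  have lip: "(norm f)-lipschitz_on UNIV (lip0_apply f)" for f :: "'a lip0"
    by transfer (auto intro: lipschitz_on_Inf)
  have le: "norm f \<le> L" if "L-lipschitz_on UNIV (lip0_apply f)" for f :: "'a lip0" and L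
    using that by transfer (rule Inf_lipschitz_le)
  fix a b c :: "'a lip0" and r s :: real
  show "a + b + c = a + (b + c)" by transfer (simp add: algebra_simps)
  show "a + b = b + a" by transfer (simp add: algebra_simps)
  show "0 + a = a" by transfer simp
  show "- a + a = 0" by transfer simp
  show "a - b = a + - b" by transfer simp
  show "r *\<^sub>R (a + b) = r *\<^sub>R a + r *\<^sub>R b" by transfer (simp add: algebra_simps)
  show "(r + s) *\<^sub>R a = r *\<^sub>R a + s *\<^sub>R a" by transfer (simp add: algebra_simps)
  show "r *\<^sub>R s *\<^sub>R a = (r * s) *\<^sub>R a" by transfer (simp add: mult.assoc)
  show "1 *\<^sub>R a = a" by transfer simp
  show "dist a b = norm (a - b)" by (rule dist_lip0_def)
  show "sgn a = inverse (norm a) *\<^sub>R a" by (rule sgn_lip0_def)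
  show "uniformity = (INF e\<in>{0 <..}. principal {(x, y :: 'a lip0). dist x y < e})"
    by (rule uniformity_lip0_def)
  show "open U = (\<forall>x\<in>U. \<forall>\<^sub>F (x', y) in uniformity. x' = x \<longrightarrow> y \<in> U)" for U :: "'a lip0 set"
    by (rule open_lip0_def)
  show "(norm a = 0) = (a = 0)"
  proof
    assume "norm a = 0"
    then have "dist (lip0_apply a x) (lip0_apply a basepoint) \<le> 0" for x
      using lipschitz_onD[OF lip[of a], of x basepoint] by simp
    then have "lip0_apply a x = 0" for x by simp
    then show "a = 0" by (intro lip0_eqI) (simp add: zero_lip0.rep_eq)
  next
    assume "a = 0"
    then have "norm a \<le> 0"
      by (intro le) (auto simp: zero_lip0.rep_eq intro: lipschitz_intros)
    then show "norm a = 0" using lipschitz_on_nonneg[OF lip[of a]] by simp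
  qed
  show "norm (a + b) \<le> norm a + norm b"
    by (intro le) (auto simp: plus_lip0.rep_eq intro!: lipschitz_on_add lip)
  have sc: "norm (t *\<^sub>R f) \<le> \<bar>t\<bar> * norm f" for t and f :: "'a lip0"
    by (intro le) (auto simp: scaleR_lip0.rep_eq simp del: real_scaleR_def
        intro!: lipschitz_scaleR lip)
  show "norm (r *\<^sub>R a) = \<bar>r\<bar> * norm a"
  proof (cases "r = 0")
    case True
    then show ?thesis
      using sc[of r a] lipschitz_on_nonneg[OF lip[of "r *\<^sub>R a"]] by simp
  next
    case False
    have "inverse r *\<^sub>R (r *\<^sub>R a) = a"
      using False by (transfer) (simp add: fun_eq_iff)
    then have "norm a \<le> \<bar>inverse r\<bar> * norm (r *\<^sub>R a)"
      using sc[of "inverse r" "r *\<^sub>R a"] by simp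
    then have "\<bar>r\<bar> * norm a \<le> norm (r *\<^sub>R a)"
      using False by (simp add: field_simps abs_inverse)
    then show ?thesis using sc[of r a] by simp
  qed
qed

end

lemma lip0_lipschitz: "(norm f)-lipschitz_on UNIV (lip0_apply f)"
  by transfer (auto intro: lipschitz_on_Inf)

lemma norm_lip0_le: "L-lipschitz_on UNIV (lip0_apply f) \<Longrightarrow> norm f \<le> L"
  by transfer (rule Inf_lipschitz_le)

lemma abs_lip0_le: "\<bar>lip0_apply f x\<bar> \<le> norm f * dist x basepoint"
  using lipschitz_onD[OF lip0_lipschitz[of f], of x basepoint] by simp

type_synonym 'a lip0_dual = "'a lip0 \<Rightarrow>\<^sub>L real"

lift_definition eval_functional :: "'a::pointed_metric_space \<Rightarrow> 'a lip0_dual"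
  is "\<lambda>x f. lip0_apply f x"
proof (rule bounded_linear_intro)
  show "norm (lip0_apply f x) \<le> norm f * dist x basepoint" for f and x :: 'a
    using abs_lip0_le by simp
qed (simp_all add: plus_lip0.rep_eq scaleR_lip0.rep_eq)

definition free_space :: "'a::pointed_metric_space lip0_dual set"
  where "free_space = closure (span (range eval_functional))"

definition derivation_at :: "'a::pointed_metric_space \<Rightarrow> 'a lip0_dual \<Rightarrow> bool"
  where "derivation_at x \<phi> \<longleftrightarrow>
    (\<forall>f. (\<exists>c. \<forall>\<^sub>F y in nhds x. lip0_apply f y = c) \<longrightarrow> blinfun_apply \<phi> f = 0)"

definition derivations :: "'a::pointed_metric_space \<Rightarrow> 'a lip0_dual set"
  where "derivations x = {\<phi>. derivation_at x \<phi>}"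

definition cutoff :: "int \<Rightarrow> 'a::pointed_metric_space \<Rightarrow> real"
  where "cutoff n x =
    (if dist x basepoint \<le> 2 powi n then 1
     else if dist x basepoint \<le> 2 powi (n + 1) then 2 - 2 powi (- n) * dist x basepoint
     else 0)"

lemma cutoff_alt:
  "cutoff n x = max 0 (min 1 (2 - 2 powi (- n) * dist x basepoint))"
proof -
  define p :: real where "p = 2 powi n"
  have p: "p > 0" "2 powi (n + 1) = 2 * p" "(2::real) powi (- n) = 1 / p"
    by (simp_all add: p_def power_int_add power_int_minus_divide)
  show ?thesis
    unfolding cutoff_def p(2,3) p_def[symmetric] using p(1)
    by (auto simp: max_def min_def field_simps)
qed

lemma cutoff_bounds: "0 \<le> cutoff n x" "cutoff n x \<le> 1"
  by (simp_all add: cutoff_alt)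

lemma cutoff_diff_le: "\<bar>cutoff n x - cutoff n y\<bar> \<le> 2 powi (- n) * dist x y"
proof -
  define q :: real where "q = 2 powi (- n)"
  have q: "q > 0" by (simp add: q_def)
  have "\<bar>cutoff n x - cutoff n y\<bar> \<le> \<bar>q * dist x basepoint - q * dist y basepoint\<bar>"
    unfolding cutoff_alt q_def[symmetric] by linarith
  also have "\<dots> = q * \<bar>dist x basepoint - dist y basepoint\<bar>"
    using q by (simp add: abs_mult flip: right_diff_distrib)
  also have "\<dots> \<le> q * dist x y"
    using q abs_dist_diff_le[of x basepoint y] by (simp add: dist_commute)
  finally show ?thesis by (simp add: q_def)
qed

lemma cutoff_mult_lipschitz:
  fixes f :: "'a::pointed_metric_space lip0"
  shows "(norm f * 3)-lipschitz_on UNIV (\<lambda>x. lip0_apply f x * cutoff n x)"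
proof (rule lipschitz_onI)
  define p :: real where "p = 2 powi n"
  have p: "p > 0" "2 powi (n + 1) = 2 * p" "(2::real) powi (- n) = 1 / p"
    by (simp_all add: p_def power_int_add power_int_minus_divide)
  have main: "\<bar>lip0_apply f x * cutoff n x - lip0_apply f y * cutoff n y\<bar> \<le> norm f * 3 * dist x y"
    if le: "dist x basepoint \<le> dist y basepoint" for x y :: 'a
  proof (cases "dist x basepoint \<le> 2 * p")
    case True
    have "\<bar>lip0_apply f x\<bar> \<le> norm f * (2 * p)"
      using abs_lip0_le[of f x] mult_left_mono[OF True, of "norm f"] by simp
    then have "\<bar>lip0_apply f x\<bar> * \<bar>cutoff n x - cutoff n y\<bar> \<le> norm f * (2 * p) * (1 / p * dist x y)"
      using cutoff_diff_le[of n x y] p by (intro mult_mono) auto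
    then have 1: "\<bar>lip0_apply f x * (cutoff n x - cutoff n y)\<bar> \<le> norm f * 2 * dist x y"
      using p(1) by (simp add: abs_mult)
    have "\<bar>lip0_apply f x - lip0_apply f y\<bar> * \<bar>cutoff n y\<bar> \<le> norm f * dist x y * 1"
      using lipschitz_onD[OF lip0_lipschitz[of f], of x y] cutoff_bounds[of n y]
      by (intro mult_mono) (auto simp: dist_real_def)
    then have 2: "\<bar>(lip0_apply f x - lip0_apply f y) * cutoff n y\<bar> \<le> norm f * dist x y"
      by (simp add: abs_mult)
    have "lip0_apply f x * cutoff n x - lip0_apply f y * cutoff n y
        = lip0_apply f x * (cutoff n x - cutoff n y)
          + (lip0_apply f x - lip0_apply f y) * cutoff n y"
      by (simp add: algebra_simps)
    with 1 2 show ?thesis by linarith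
  next
    case False
    then have "cutoff n x = 0" "cutoff n y = 0"
      using le p by (simp_all add: cutoff_def flip: p_def)
    then show ?thesis by simp
  qed
  show "dist (lip0_apply f x * cutoff n x) (lip0_apply f y * cutoff n y) \<le> norm f * 3 * dist x y"
    for x y
    using main[of x y] main[of y x]
    by (cases "dist x basepoint \<le> dist y basepoint")
      (auto simp: dist_real_def dist_commute abs_minus_commute)
qed simp

lift_definition cutoff_mult :: "int \<Rightarrow> 'a::pointed_metric_space lip0 \<Rightarrow> 'a lip0"
  is "\<lambda>n f x. f x * cutoff n x"
proof -
  fix n :: int and f :: "'a \<Rightarrow> real"
  assume "f basepoint = 0 \<and> (\<exists>L. L-lipschitz_on UNIV f)"
  then show "f basepoint * cutoff n basepoint = 0
      \<and> (\<exists>L. L-lipschitz_on UNIV (\<lambda>x. f x * cutoff n x))"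
    using cutoff_mult_lipschitz[of "Abs_lip0 f" n] by (auto simp: Abs_lip0_inverse)
qed

lift_definition cutoff_op :: "int \<Rightarrow> 'a::pointed_metric_space lip0 \<Rightarrow>\<^sub>L 'a lip0"
  is cutoff_mult
proof (rule bounded_linear_intro)
  fix n and f g :: "'a lip0" and r :: real
  show "cutoff_mult n (f + g) = cutoff_mult n f + cutoff_mult n g"
    by transfer (simp add: algebra_simps)
  show "cutoff_mult n (r *\<^sub>R f) = r *\<^sub>R cutoff_mult n f"
    by transfer (simp add: mult.assoc)
  show "norm (cutoff_mult n f) \<le> norm f * 3"
    by (rule norm_lip0_le) (simp add: cutoff_mult.rep_eq cutoff_mult_lipschitz)
qed

text \<open>The adjoint of \<^term>\<open>cutoff_op n\<close> is precomposition with it.\<close>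

definition concentrated_at_infinity :: "'a::pointed_metric_space lip0_dual set"
  where "concentrated_at_infinity = {\<phi>. \<forall>n. \<phi> o\<^sub>L cutoff_op n = 0}"

text \<open>
  Convergence \<^const>\<open>has_sum\<close> is unconditional and in norm. Families are taken in the
  extensional product \<^const>\<open>PiE\<close> so that uniqueness is not spoilt by values outside
  the index set.
\<close>

definition internal_l1_sum :: "'i set \<Rightarrow> ('i \<Rightarrow> 'b::real_normed_vector set) \<Rightarrow> bool"
  where "internal_l1_sum I Y \<longleftrightarrow>
    (\<forall>i\<in>I. subspace (Y i) \<and> closed (Y i)) \<and>
    (\<forall>v. \<exists>!u. u \<in> PiE I Y \<and> (u has_sum v) I) \<and>
    (\<forall>v. \<forall>u \<in> PiE I Y. (u has_sum v) I \<longrightarrow> ((\<lambda>i. norm (u i)) has_sum norm v) I)"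

datatype 'a summand = Free | Deriv 'a | Infinity

primrec summand_space :: "'a::pointed_metric_space summand \<Rightarrow> 'a lip0_dual set"
  where
    "summand_space Free = free_space"
  | "summand_space (Deriv x) = derivations x"
  | "summand_space Infinity = concentrated_at_infinity"

end

theory Submission
  imports Defs
begin

text \<open>
  The norm is additive on finite sums of components because the components can be tested
  independently: functions nearly norming a finitely supported element, finitely many derivations
  and a functional at infinity may be glued along a finite set, tiny balls and a far region at the
  cost of a factor \<open>1 + \<epsilon>\<close>, and the result is extended by McShane. Hence the sum is direct,
  isometrically an \<open>\<ell>\<^sub>1\<close>-sum, and complete, and it remains to show that it is dense. By a gliding hump
  argument the localizations of a functional to balls shrinking to a point converge in norm, to a
  derivation, and its truncations to large balls converge in norm, with a remainder at infinity.
  Since a countable complete space is scattered, density then follows locally, at an isolated point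
  of the set of points where it could fail.
\<close>

subsection \<open>Metric and Banach space preliminaries\<close>

text \<open>Two obstacles shape the proof. Secondly, away from the base point, multiplication by a
  bump of radius r is not bounded uniformly in r, since f(x) need not vanish. Replacing f by f -
  f(x) restores a uniform bound, and the correction is a multiple of an evaluation, hence invisible
  modulo \<open>free_space\<close>. This is why the density argument runs inside a closed subspace Z
  containing all summands instead of tracking components: membership in Z does not depend on the
  point at which a weight is centred. Properness enters twice: it gives the completeness behind
  Baire's theorem, and it makes balls and annuli compact, so that finitely many good neighbourhoods
  cover them.\<close>

lemma subspace_closure:
  fixes S :: "'b::real_normed_vector set"
  assumes "subspace S"
  shows "subspace (closure S)"
  unfolding subspace_def
proof (intro conjI ballI allI)
  show "0 \<in> closure S"
    using subspace_0[OF assms] closure_subset by blast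
next
  fix x y assume "x \<in> closure S" "y \<in> closure S"
  then obtain f g where f: "\<And>n. f n \<in> S" "f \<longlonglongrightarrow> x" and g: "\<And>n. g n \<in> S" "g \<longlonglongrightarrow> y"
    unfolding closure_sequential by blast
  show "x + y \<in> closure S"
    unfolding closure_sequential
    by (intro exI[of _ "\<lambda>n. f n + g n"])
      (use f g in \<open>auto intro!: tendsto_intros subspace_add[OF assms]\<close>)
next
  fix x and c :: real assume "x \<in> closure S"
  then obtain f where f: "\<And>n. f n \<in> S" "f \<longlonglongrightarrow> x"
    unfolding closure_sequential by blast
  show "c *\<^sub>R x \<in> closure S"
    unfolding closure_sequential
    by (intro exI[of _ "\<lambda>n. c *\<^sub>R f n"])
      (use f in \<open>auto intro!: tendsto_intros subspace_scale[OF assms]\<close>)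
qed

text \<open>The family vanishes off F so that two representations with different supports can be
  compared by summing over any common finite superset.\<close>

lemma span_Union_finite_sum:
  fixes Y :: "'i \<Rightarrow> 'b::real_vector set"
  assumes sub: "\<And>i. i \<in> I \<Longrightarrow> subspace (Y i)"
    and w: "w \<in> span (\<Union>i\<in>I. Y i)"
  shows "\<exists>F c. finite F \<and> F \<subseteq> I \<and> (\<forall>i\<in>I. c i \<in> Y i) \<and> (\<forall>i. i \<notin> F \<longrightarrow> c i = 0) \<and> w = (\<Sum>i\<in>F. c i)"
    (is "?P w")
  using w
proof (induction rule: span_induct_alt)
  case base
  show ?case
    by (rule exI[of _ "{}"], rule exI[of _ "\<lambda>_. 0"]) (auto simp: subspace_0 sub)
next
  case (step r x y)
  then obtain F c j where F: "finite F" "F \<subseteq> I" "\<forall>i\<in>I. c i \<in> Y i" "\<forall>i. i \<notin> F \<longrightarrow> c i = 0"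
      "y = (\<Sum>i\<in>F. c i)" and j: "j \<in> I" "x \<in> Y j"
    by blast
  define c' where "c' = c(j := r *\<^sub>R x + c j)"
  have "(\<Sum>i\<in>F. c i) = (\<Sum>i\<in>insert j F. c i)"
    using F by (intro sum.mono_neutral_left) auto
  then have "(\<Sum>i\<in>insert j F. c' i) = r *\<^sub>R x + (\<Sum>i\<in>F. c i)"
    using F(1) by (simp add: sum.insert_remove c'_def)
  moreover have "\<forall>i\<in>I. c' i \<in> Y i"
    using F(3) j sub by (auto simp: c'_def intro!: subspace_add subspace_scale)
  ultimately show ?case
    using F j by (intro exI[of _ "insert j F"] exI[of _ c']) (auto simp: c'_def)
qed

text \<open>Finite additivity of the norm makes the component maps on the algebraic sum contractive, so
  the components of an approximating sequence converge.\<close>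

lemma internal_l1_sumI:
  fixes Y :: "'i \<Rightarrow> 'b::banach set"
  assumes sub: "\<And>i. i \<in> I \<Longrightarrow> subspace (Y i)" and closed: "\<And>i. i \<in> I \<Longrightarrow> closed (Y i)"
    and norm_sum: "\<And>F u. finite F \<Longrightarrow> F \<subseteq> I \<Longrightarrow> (\<And>i. i \<in> F \<Longrightarrow> u i \<in> Y i) \<Longrightarrow>
      norm (\<Sum>i\<in>F. u i) = (\<Sum>i\<in>F. norm (u i))"
    and dense: "closure (span (\<Union>i\<in>I. Y i)) = UNIV"
  shows "internal_l1_sum I Y"
proof -
  have norm_has_sum: "((\<lambda>i. norm (u i)) has_sum norm v) I"
    if u: "\<And>i. i \<in> I \<Longrightarrow> u i \<in> Y i" and "(u has_sum v) I" for u v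
  proof -
    have "(sum u \<longlongrightarrow> v) (finite_subsets_at_top I)"
      using that by (simp add: has_sum_def)
    then have "((\<lambda>F. norm (sum u F)) \<longlongrightarrow> norm v) (finite_subsets_at_top I)"
      by (rule tendsto_norm)
    moreover have "\<forall>\<^sub>F F in finite_subsets_at_top I. norm (sum u F) = (\<Sum>i\<in>F. norm (u i))"
      using u by (intro eventually_finite_subsets_at_top_weakI norm_sum) auto
    ultimately show ?thesis
      unfolding has_sum_def by (rule Lim_transform_eventually)
  qed
  have unique: "u = u'"
    if u: "u \<in> PiE I Y" "(u has_sum v) I" and u': "u' \<in> PiE I Y" "(u' has_sum v) I" for u u' v
  proof (rule PiE_ext[OF u(1) u'(1)])
    fix i assume i: "i \<in> I"
    have "((\<lambda>i. - u' i) has_sum - v) I"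
      using u'(2) by (simp add: has_sum_uminus)
    from has_sum_add[OF u(2) this] have "((\<lambda>i. u i - u' i) has_sum 0) I"
      by simp
    moreover have "u i - u' i \<in> Y i" if "i \<in> I" for i
      using u(1) u'(1) sub that by (intro subspace_diff) auto
    ultimately have "((\<lambda>i. norm (u i - u' i)) has_sum 0) I"
      using norm_has_sum by fastforce
    then have "norm (u i - u' i) = 0"
      using i by (intro nonneg_has_sum_le_0D[of _ _ 0]) auto
    then show "u i = u' i" by simp
  qed
  have exists: "\<exists>u \<in> PiE I Y. (u has_sum v) I" for v
  proof -
    have "v \<in> closure (span (\<Union>i\<in>I. Y i))" using dense by simp
    then obtain w where w: "\<And>k. w k \<in> span (\<Union>i\<in>I. Y i)" "w \<longlonglongrightarrow> v"
      unfolding closure_sequential by blast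
    have "\<forall>k. \<exists>F c. finite F \<and> F \<subseteq> I \<and> (\<forall>i\<in>I. c i \<in> Y i) \<and> (\<forall>i. i \<notin> F \<longrightarrow> c i = 0) \<and> w k = (\<Sum>i\<in>F. c i)"
      using w(1) by (intro allI span_Union_finite_sum sub)
    then obtain F c where F: "\<And>k. finite (F k)" "\<And>k. F k \<subseteq> I" "\<And>k i. i \<in> I \<Longrightarrow> c k i \<in> Y i"
        "\<And>k i. i \<notin> F k \<Longrightarrow> c k i = 0" "\<And>k. w k = (\<Sum>i\<in>F k. c k i)"
      by metis
    have diff: "(\<Sum>i\<in>G. norm (c k i - c l i)) \<le> norm (w k - w l)" if G: "finite G" "G \<subseteq> I" for G k l
    proof -
      \<comment> \<open>Over a set containing both supports the sums are exactly \<open>w k\<close>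
        and \<open>w l\<close>, so finite additivity turns the norm of their difference into a sum
        of component norms.\<close>
      let ?H = "G \<union> F k \<union> F l"
      have H: "finite ?H" "?H \<subseteq> I" using F G by auto
      have eq: "w m = (\<Sum>i\<in>?H. c m i)" if "m = k \<or> m = l" for m
        using that F H by (subst F(5), intro sum.mono_neutral_left) auto
      have "(\<Sum>i\<in>G. norm (c k i - c l i)) \<le> (\<Sum>i\<in>?H. norm (c k i - c l i))"
        using H by (intro sum_mono2) auto
      also have "\<dots> = norm (\<Sum>i\<in>?H. c k i - c l i)"
      proof (intro norm_sum[symmetric] H)
        fix i assume "i \<in> ?H"
        then have "i \<in> I" using H(2) by blast
        then show "c k i - c l i \<in> Y i" using F(3) sub by (intro subspace_diff) auto
      qed
      also have "\<dots> = norm (w k - w l)"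
        using eq[of k] eq[of l] by (simp add: sum_subtractf)
      finally show ?thesis .
    qed
    have Cauchy: "Cauchy (\<lambda>k. c k i)" if "i \<in> I" for i
    proof (rule CauchyI)
      fix e :: real assume "0 < e"
      then obtain N where N: "\<And>m n. m \<ge> N \<Longrightarrow> n \<ge> N \<Longrightarrow> norm (w m - w n) < e"
        using CauchyD[OF LIMSEQ_imp_Cauchy[OF w(2)]] by blast
      show "\<exists>M. \<forall>m\<ge>M. \<forall>n\<ge>M. norm (c m i - c n i) < e"
        using diff[of "{i}"] that N by (intro exI[of _ N]) (auto, meson order.strict_trans1)
    qed
    \<comment> \<open>\<open>restrict\<close> puts the limits into the extensional product over
      which \<open>internal_l1_sum\<close> quantifies.\<close>
    define u where "u = restrict (\<lambda>i. lim (\<lambda>k. c k i)) I"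
    have u: "(\<lambda>k. c k i) \<longlonglongrightarrow> u i" if "i \<in> I" for i
      using Cauchy[OF that] that
      by (simp add: u_def Cauchy_convergent_iff convergent_LIMSEQ_iff)
    have "u i \<in> Y i" if "i \<in> I" for i
      using closed_sequentially[OF closed[OF that] _ u[OF that]] F(3)[OF that] by blast
    then have "u \<in> PiE I Y" by (auto simp: u_def)
    moreover have "(u has_sum v) I"
      unfolding has_sum_def tendsto_iff
    proof (intro allI impI)
      fix e :: real assume e: "0 < e"
      \<comment> \<open>Limits preserve only weak inequalities: two errors of at most e / 3 still
        add up to something strictly below e.\<close>
      obtain N where N: "\<And>m n. m \<ge> N \<Longrightarrow> n \<ge> N \<Longrightarrow> norm (w m - w n) < e / 3"
        using CauchyD[OF LIMSEQ_imp_Cauchy[OF w(2)], of "e / 3"] e by auto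
      have wN: "norm (v - w N) \<le> e / 3"
      proof (rule Lim_bounded[of _ _ N])
        show "(\<lambda>l. norm (w l - w N)) \<longlonglongrightarrow> norm (v - w N)"
          by (intro tendsto_intros w)
        show "\<forall>l\<ge>N. norm (w l - w N) \<le> e / 3" using N by (auto intro: less_imp_le)
      qed
      show "\<forall>\<^sub>F G in finite_subsets_at_top I. dist (sum u G) v < e"
        unfolding eventually_finite_subsets_at_top
      proof (intro exI conjI allI impI)
        show "finite (F N)" "F N \<subseteq> I" using F by auto
        fix G assume G: "finite G \<and> F N \<subseteq> G \<and> G \<subseteq> I"
        have "norm (\<Sum>i\<in>G. u i - c N i) \<le> e / 3"
        proof (rule Lim_bounded[of _ _ N])
          show "(\<lambda>l. norm (\<Sum>i\<in>G. c l i - c N i)) \<longlonglongrightarrow> norm (\<Sum>i\<in>G. u i - c N i)"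
            using G by (intro tendsto_intros u) auto
          show "\<forall>l\<ge>N. norm (\<Sum>i\<in>G. c l i - c N i) \<le> e / 3"
          proof (intro allI impI)
            fix l assume "l \<ge> N"
            have "norm (\<Sum>i\<in>G. c l i - c N i) \<le> (\<Sum>i\<in>G. norm (c l i - c N i))"
              by (rule Real_Vector_Spaces.norm_sum)
            also have "\<dots> \<le> norm (w l - w N)" using G by (intro diff) auto
            also have "\<dots> \<le> e / 3" using N[of l N] \<open>l \<ge> N\<close> by simp
            finally show "norm (\<Sum>i\<in>G. c l i - c N i) \<le> e / 3" .
          qed
        qed
        moreover have "(\<Sum>i\<in>G. c N i) = w N"
          using G F by (subst F(5), intro sum.mono_neutral_right) auto
        ultimately have "norm (sum u G - w N) \<le> e / 3" by (simp add: sum_subtractf)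
        then have "norm (sum u G - v) \<le> e / 3 + e / 3"
          using wN norm_triangle_ineq[of "sum u G - w N" "w N - v"]
          by (simp add: norm_minus_commute)
        then show "dist (sum u G) v < e" using e by (simp add: dist_norm)
      qed
    qed
    ultimately show ?thesis by blast
  qed
  show ?thesis
    unfolding internal_l1_sum_def
    using sub closed exists unique norm_has_sum by (fastforce simp: PiE_iff)
qed

text \<open>McShane's formula: an infimum of the L-Lipschitz functions
  \<open>f a + L * dist a x\<close> is L-Lipschitz once it is finite. The inequality
  \<open>below\<close> provides the lower bound and also shows that at a point of S the infimum is
  attained by the cone at that point.\<close>

lemma lipschitz_extension:
  fixes f :: "'a::metric_space \<Rightarrow> real"
  assumes f: "L-lipschitz_on S f"
  obtains g where "L-lipschitz_on UNIV g" "\<And>x. x \<in> S \<Longrightarrow> g x = f x"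
proof (cases "S = {}")
  case True
  show ?thesis
    by (rule that[of "\<lambda>_. 0"]) (use True lipschitz_on_nonneg[OF f] in \<open>auto intro!: lipschitz_onI\<close>)
next
  case False
  have L: "L \<ge> 0" by (rule lipschitz_on_nonneg[OF f])
  define g where "g x = (INF a\<in>S. f a + L * dist a x)" for x
  have below: "f b - L * dist b x \<le> f a + L * dist a x" if "a \<in> S" "b \<in> S" for a b x
  proof -
    have "f b - f a \<le> L * dist b a"
      using lipschitz_onD[OF f that(2,1)] by (simp add: dist_real_def)
    also have "\<dots> \<le> L * (dist b x + dist a x)"
      using L by (intro mult_left_mono) (metis dist_triangle2)
    finally show ?thesis by (simp add: algebra_simps)
  qed
  have bdd: "bdd_below ((\<lambda>a. f a + L * dist a x) ` S)" for x
    using below False by (meson bdd_belowI2 ex_in_conv)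
  have le: "g x \<le> g y + L * dist x y" for x y
  proof -
    have "g x - L * dist x y \<le> g y"
      unfolding g_def[of y]
    proof (rule cINF_greatest[OF False])
      fix a assume a: "a \<in> S"
      have "g x \<le> f a + L * dist a x"
        unfolding g_def using bdd a by (rule cINF_lower)
      also have "\<dots> \<le> f a + L * (dist a y + dist x y)"
        using L by (intro add_left_mono mult_left_mono) (metis dist_triangle2)
      finally show "g x - L * dist x y \<le> f a + L * dist a y"
        by (simp add: algebra_simps)
    qed
    then show ?thesis by simp
  qed
  show ?thesis
  proof (rule that[of g])
    show "L-lipschitz_on UNIV g"
    proof (rule lipschitz_onI[OF _ L])
      show "dist (g x) (g y) \<le> L * dist x y" for x y
        using le[of x y] le[of y x] by (simp add: dist_real_def dist_commute abs_le_iff)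
    qed
    show "g x = f x" if x: "x \<in> S" for x
    proof (rule antisym)
      show "g x \<le> f x"
        unfolding g_def using cINF_lower[OF bdd x, of x] by simp
      show "f x \<le> g x"
        unfolding g_def using below[OF _ x, of _ x] by (intro cINF_greatest[OF False]) simp
    qed
  qed
qed

text \<open>In a closed set without isolated points every singleton is relatively closed with empty
  relative interior, so by Baire's theorem countably many of them cannot exhaust the set unless it
  is empty.\<close>

lemma countable_closed_has_isolated_point:
  fixes B :: "'a::metric_space set"
  assumes complete: "complete (UNIV :: 'a set)" and "closed B" "countable B" "B \<noteq> {}"
  obtains x where "x \<in> B" "\<not> x islimpt B"
proof (rule ccontr)
  assume "\<not> thesis"
  then have perfect: "\<And>x. x \<in> B \<Longrightarrow> x islimpt B" using that by blast
  have "top_of_set B interior_of \<Union>((\<lambda>x. {x}) ` B) = {}"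
  proof (rule Baire_category_alt)
    have "completely_metrizable_space (euclidean :: 'a topology)"
      using Met_TC.completely_metrizable_space_mtopology complete by auto
    then show "completely_metrizable_space (top_of_set B) \<or>
        locally_compact_space (top_of_set B) \<and> regular_space (top_of_set B)"
      using \<open>closed B\<close> completely_metrizable_space_closedin[of euclidean B]
      by (simp flip: closed_closedin)
    show "countable ((\<lambda>x. {x}) ` B)" using \<open>countable B\<close> by blast
    fix T assume "T \<in> (\<lambda>x. {x}) ` B"
    then obtain x where T: "T = {x}" "x \<in> B" by blast
    have "U = {}" if U: "openin (top_of_set B) U" "U \<subseteq> {x}" for U
    proof (rule ccontr)
      assume "U \<noteq> {}"
      then have "U = {x}" using U by blast
      then obtain V where "open V" "{x} = B \<inter> V" using U unfolding openin_open by blast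
      then show False using perfect[OF T(2)] unfolding islimpt_def by blast
    qed
    then show "closedin (top_of_set B) T \<and> top_of_set B interior_of T = {}"
      using T by (auto simp: interior_of_def closed_subset)
  qed
  then show False
    using \<open>B \<noteq> {}\<close> by (simp add: interior_of_openin)
qed

subsection \<open>Additivity of the norm\<close>

text \<open>Subtracting the value at the base point leaves differences unchanged, so any Lipschitz
  function yields an element whose norm is at most its Lipschitz constant.\<close>

definition lip0_of :: "('a::pointed_metric_space \<Rightarrow> real) \<Rightarrow> 'a lip0"
  where "lip0_of f = Abs_lip0 (\<lambda>y. f y - f basepoint)"

lemma lip0_of_apply:
  assumes "L-lipschitz_on UNIV f"
  shows "lip0_apply (lip0_of f) y = f y - f basepoint"
proof -
  have "(L + 0)-lipschitz_on UNIV (\<lambda>y. f y - f basepoint)"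
    by (intro lipschitz_intros assms)
  then show ?thesis
    unfolding lip0_of_def by (subst Abs_lip0_inverse) auto
qed

lemma norm_lip0_of:
  assumes "L-lipschitz_on UNIV f"
  shows "norm (lip0_of f) \<le> L"
proof -
  have "(L + 0)-lipschitz_on UNIV (\<lambda>y. f y - f basepoint)"
    by (intro lipschitz_intros assms)
  then show ?thesis
    by (intro norm_lip0_le) (simp add: lip0_of_apply[OF assms])
qed

lemma lip0_of_add:
  assumes "K-lipschitz_on UNIV f" "L-lipschitz_on UNIV g"
  shows "lip0_of (\<lambda>y. f y + g y) = lip0_of f + lip0_of g"
  using lip0_of_apply[OF lipschitz_on_add[OF assms]] lip0_of_apply[OF assms(1)]
    lip0_of_apply[OF assms(2)]
  by (intro lip0_eqI) (simp add: plus_lip0.rep_eq)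

lemma abs_lip0_diff_le: "\<bar>lip0_apply f x - lip0_apply f y\<bar> \<le> norm f * dist x y"
  using lipschitz_onD[OF lip0_lipschitz[of f], of x y] by (simp add: dist_real_def)

text \<open>A one-sided bound is enough because the unit ball is symmetric: it is applied to the
  normalization of f and to its negative.\<close>

lemma norm_blinfun_leI:
  fixes \<phi> :: "'b::real_normed_vector \<Rightarrow>\<^sub>L real"
  assumes le: "\<And>f. norm f \<le> 1 \<Longrightarrow> blinfun_apply \<phi> f \<le> b"
  shows "norm \<phi> \<le> b"
proof (rule norm_blinfun_bound)
  show "0 \<le> b" using le[of 0] by (simp add: blinfun.zero_right)
  fix f :: 'b
  show "norm (blinfun_apply \<phi> f) \<le> b * norm f"
  proof (cases "f = 0")
    case False
    have "blinfun_apply \<phi> (sgn f) \<le> b" "blinfun_apply \<phi> (- sgn f) \<le> b"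
      by (auto intro!: le simp: norm_sgn)
    then have "\<bar>blinfun_apply \<phi> f\<bar> / norm f \<le> b"
      by (auto simp: sgn_div_norm blinfun.scaleR_right blinfun.minus_right abs_if field_simps)
    then show ?thesis using False by (simp add: field_simps)
  qed (simp add: blinfun.zero_right)
qed

lemma norm_blinfun_almost_attained:
  fixes \<phi> :: "'b::real_normed_vector \<Rightarrow>\<^sub>L real"
  assumes "e > 0"
  obtains f where "norm f \<le> 1" "norm \<phi> - e < blinfun_apply \<phi> f"
proof -
  have "\<not> norm \<phi> \<le> norm \<phi> - e" using assms by simp
  then obtain f where "norm f \<le> 1" "\<not> blinfun_apply \<phi> f \<le> norm \<phi> - e"
    using norm_blinfun_leI by blast
  then show ?thesis by (intro that) auto
qed

text \<open>Choosing f and g nearly norming gives a single function of norm at most 1 + e on which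
  each functional is nearly as large as its norm.\<close>

lemma norm_add_eqI:
  fixes \<phi> \<psi> :: "'b::real_normed_vector \<Rightarrow>\<^sub>L real"
  assumes glue: "\<And>e f g. e > 0 \<Longrightarrow> norm f \<le> 1 \<Longrightarrow> norm g \<le> 1 \<Longrightarrow>
    \<exists>h. norm h \<le> 1 + e \<and> blinfun_apply \<phi> h = blinfun_apply \<phi> f \<and> blinfun_apply \<psi> h = blinfun_apply \<psi> g"
  shows "norm (\<phi> + \<psi>) = norm \<phi> + norm \<psi>"
proof (rule antisym[OF norm_triangle_ineq], rule field_le_epsilon)
  fix \<eta> :: real assume \<eta>: "0 < \<eta>"
  define N where "N = norm (\<phi> + \<psi>)"
  \<comment> \<open>Solves 2 * e + N * e = \<eta>: the first term is the loss in almost attaining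
    the two norms, the second comes from the norm 1 + e of the glued function.\<close>
  define e where "e = \<eta> / (N + 2)"
  have N: "N \<ge> 0" by (simp add: N_def)
  then have e: "e > 0" "e * (N + 2) = \<eta>" using \<eta> by (simp_all add: e_def)
  obtain f where f: "norm f \<le> 1" "norm \<phi> - e < blinfun_apply \<phi> f"
    by (rule norm_blinfun_almost_attained[OF e(1)])
  obtain g where g: "norm g \<le> 1" "norm \<psi> - e < blinfun_apply \<psi> g"
    by (rule norm_blinfun_almost_attained[OF e(1)])
  obtain h where h: "norm h \<le> 1 + e" "blinfun_apply \<phi> h = blinfun_apply \<phi> f"
      "blinfun_apply \<psi> h = blinfun_apply \<psi> g"
    using glue[OF e(1) f(1) g(1)] by blast
  have "norm \<phi> + norm \<psi> - 2 * e \<le> blinfun_apply (\<phi> + \<psi>) h"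
    using f g h by (simp add: blinfun.add_left)
  also have "\<dots> \<le> N * norm h"
    unfolding N_def using norm_blinfun[of "\<phi> + \<psi>" h] by simp
  also have "\<dots> \<le> N * (1 + e)" using N h(1) by (intro mult_left_mono)
  finally show "norm \<phi> + norm \<psi> \<le> norm (\<phi> + \<psi>) + \<eta>"
    using e(2) by (simp add: algebra_simps flip: N_def)
qed

lemma lipschitz_on_Un:
  assumes "L-lipschitz_on A f" "L-lipschitz_on B f"
    and "\<And>a b. a \<in> A \<Longrightarrow> b \<in> B \<Longrightarrow> dist (f a) (f b) \<le> L * dist a b"
  shows "L-lipschitz_on (A \<union> B) f"
proof (rule lipschitz_onI)
  show "0 \<le> L" by (rule lipschitz_on_nonneg[OF assms(1)])
  fix x y assume "x \<in> A \<union> B" "y \<in> A \<union> B"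
  then show "dist (f x) (f y) \<le> L * dist x y"
    using assms lipschitz_onD[OF assms(1)] lipschitz_onD[OF assms(2)]
    by (metis Un_iff dist_commute)
qed

text \<open>A derivation does not see additive constants near x. This freedom lets a glued function
  follow g near x while keeping the value of f at x.\<close>

lemma derivation_at_eqI:
  assumes "derivation_at x \<phi>" "r > 0"
    and "\<And>y. dist y x < r \<Longrightarrow> lip0_apply f y - lip0_apply g y = c"
  shows "blinfun_apply \<phi> f = blinfun_apply \<phi> g"
proof -
  have "\<forall>\<^sub>F y in nhds x. lip0_apply (f - g) y = c"
    unfolding eventually_nhds_metric using assms(2,3) by (auto simp: minus_lip0.rep_eq)
  then have "blinfun_apply \<phi> (f - g) = 0"
    using assms(1) unfolding derivation_at_def by blast
  then show ?thesis by (simp add: blinfun.diff_right)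
qed

text \<open>At a scale n with R < 2 ^ n the cutoff is 1 wherever f can be nonzero, so f is its own
  image under \<open>cutoff_op\<close>.\<close>

lemma concentrated_at_infinity_vanishes:
  assumes "\<phi> \<in> concentrated_at_infinity" and f: "\<And>y. R \<le> dist y basepoint \<Longrightarrow> lip0_apply f y = 0"
  shows "blinfun_apply \<phi> f = 0"
proof -
  obtain n where n: "R < 2 ^ n" using real_arch_pow[of 2 R] by auto
  have "cutoff_op (int n) f = f"
  proof (rule lip0_eqI)
    fix y
    show "lip0_apply (cutoff_op (int n) f) y = lip0_apply f y"
      using f[of y] n
      by (cases "R \<le> dist y basepoint") (auto simp: cutoff_op.rep_eq cutoff_mult.rep_eq cutoff_def)
  qed
  moreover have "blinfun_apply (\<phi> o\<^sub>L cutoff_op (int n)) f = 0"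
    using assms(1) by (simp add: concentrated_at_infinity_def)
  ultimately show ?thesis by simp
qed

definition bounded_functionals :: "'a::pointed_metric_space lip0_dual set"
  where "bounded_functionals = {\<phi>. \<exists>R. \<forall>f. (\<forall>y. dist y basepoint \<le> R \<longrightarrow> lip0_apply f y = 0) \<longrightarrow>
    blinfun_apply \<phi> f = 0}"

text \<open>Only the punctured ball is ignored; the value at x stays visible. Hence the evaluation
  at x belongs to this set, and gluing near x has to preserve f(x).\<close>

definition functionals_off :: "'a::pointed_metric_space \<Rightarrow> 'a lip0_dual set"
  where "functionals_off x = {\<phi>. \<exists>r>0. \<forall>f. (\<forall>y. y = x \<or> r \<le> dist y x \<longrightarrow> lip0_apply f y = 0) \<longrightarrow>
    blinfun_apply \<phi> f = 0}"

lemma subspace_bounded_functionals: "subspace bounded_functionals"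
  unfolding subspace_def
proof (intro conjI ballI allI)
  fix \<phi> \<psi> :: "'a lip0_dual" assume "\<phi> \<in> bounded_functionals" "\<psi> \<in> bounded_functionals"
  then obtain R S where
    "\<And>f. (\<forall>y. dist y basepoint \<le> R \<longrightarrow> lip0_apply f y = 0) \<Longrightarrow> blinfun_apply \<phi> f = 0"
    "\<And>f. (\<forall>y. dist y basepoint \<le> S \<longrightarrow> lip0_apply f y = 0) \<Longrightarrow> blinfun_apply \<psi> f = 0"
    unfolding bounded_functionals_def by blast
  then show "\<phi> + \<psi> \<in> bounded_functionals"
    unfolding bounded_functionals_def
    by (auto simp: blinfun.add_left intro!: exI[of _ "max R S"])
qed (auto simp: bounded_functionals_def blinfun.zero_left blinfun.scaleR_left)

lemma subspace_functionals_off: "subspace (functionals_off x)"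
  unfolding subspace_def
proof (intro conjI ballI allI)
  fix \<phi> \<psi> :: "'a lip0_dual" assume "\<phi> \<in> functionals_off x" "\<psi> \<in> functionals_off x"
  then obtain r s where "r > 0" "s > 0"
    "\<And>f. (\<forall>y. y = x \<or> r \<le> dist y x \<longrightarrow> lip0_apply f y = 0) \<Longrightarrow> blinfun_apply \<phi> f = 0"
    "\<And>f. (\<forall>y. y = x \<or> s \<le> dist y x \<longrightarrow> lip0_apply f y = 0) \<Longrightarrow> blinfun_apply \<psi> f = 0"
    unfolding functionals_off_def by blast
  then show "\<phi> + \<psi> \<in> functionals_off x"
    unfolding functionals_off_def
    by (auto simp: blinfun.add_left intro!: exI[of _ "min r s"])
qed (auto simp: functionals_off_def blinfun.zero_left blinfun.scaleR_left intro: exI[of _ 1])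

lemma span_eval_subset_bounded_functionals: "span (range eval_functional) \<subseteq> bounded_functionals"
proof (intro span_minimal subspace_bounded_functionals subsetI)
  fix \<phi> :: "'a lip0_dual" assume "\<phi> \<in> range eval_functional"
  then obtain p where "\<phi> = eval_functional p" by blast
  then show "\<phi> \<in> bounded_functionals"
    unfolding bounded_functionals_def
    by (auto simp: eval_functional.rep_eq intro!: exI[of _ "dist p basepoint"])
qed

lemma span_eval_subset_functionals_off: "span (range eval_functional) \<subseteq> functionals_off (x :: 'a::pointed_metric_space)"
proof (intro span_minimal subspace_functionals_off subsetI)
  fix \<phi> :: "'a lip0_dual" assume "\<phi> \<in> range eval_functional"
  then obtain p where "\<phi> = eval_functional p" by blast
  then show "\<phi> \<in> functionals_off x"
    unfolding functionals_off_def
    by (cases "p = x")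
      (auto simp: eval_functional.rep_eq intro: exI[of _ 1] exI[of _ "dist p x"])
qed

lemma concentrated_at_infinity_subset_functionals_off: "concentrated_at_infinity \<subseteq> functionals_off (x :: 'a::pointed_metric_space)"
proof
  fix \<phi> :: "'a lip0_dual" assume \<phi>: "\<phi> \<in> concentrated_at_infinity"
  have "blinfun_apply \<phi> f = 0" if f: "\<forall>y. y = x \<or> 1 \<le> dist y x \<longrightarrow> lip0_apply f y = 0" for f
  proof (rule concentrated_at_infinity_vanishes[OF \<phi>])
    fix y :: 'a assume "1 + dist x basepoint \<le> dist y basepoint"
    then have "1 \<le> dist y x" using dist_triangle[of y basepoint x] by linarith
    then show "lip0_apply f y = 0" using f by blast
  qed
  then show "\<phi> \<in> functionals_off x"
    unfolding functionals_off_def by (auto intro: exI[of _ 1])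
qed

lemma derivations_subset_functionals_off:
  assumes "(x :: 'a::pointed_metric_space) \<noteq> y"
  shows "derivations y \<subseteq> functionals_off x"
proof
  fix \<phi> :: "'a lip0_dual" assume \<phi>: "\<phi> \<in> derivations y"
  define r where "r = dist x y / 2"
  have r: "r > 0" using assms by (simp add: r_def)
  have "blinfun_apply \<phi> f = 0" if f: "\<forall>z. z = x \<or> r \<le> dist z x \<longrightarrow> lip0_apply f z = 0" for f
  proof -
    have "blinfun_apply \<phi> f = blinfun_apply \<phi> 0"
    proof (rule derivation_at_eqI[OF _ r])
      show "derivation_at y \<phi>" using \<phi> by (simp add: derivations_def)
      fix z assume "dist z y < r"
      then have "r \<le> dist z x"
        using dist_triangle[of x y z] by (simp add: r_def dist_commute)
      then show "lip0_apply f z - lip0_apply 0 z = 0" using f by (simp add: zero_lip0.rep_eq)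
    qed
    then show ?thesis by (simp add: blinfun.zero_right)
  qed
  then show "\<phi> \<in> functionals_off x"
    unfolding functionals_off_def using r by blast
qed

text \<open>Follow f on a ball that determines \<gamma> and g far outside it; a wide gap between the
  two regions pays for the unrelated values.\<close>

lemma norm_add_concentrated_at_infinity:
  assumes \<gamma>: "\<gamma> \<in> bounded_functionals" and \<psi>: "\<psi> \<in> concentrated_at_infinity"
  shows "norm (\<gamma> + \<psi>) = norm \<gamma> + norm \<psi>"
proof (rule norm_add_eqI)
  fix e :: real and f g :: "'a lip0"
  assume e: "e > 0" and f: "norm f \<le> 1" and g: "norm g \<le> 1"
  obtain S where S: "\<And>f. (\<forall>y. dist y basepoint \<le> S \<longrightarrow> lip0_apply f y = 0) \<Longrightarrow> blinfun_apply \<gamma> f = 0"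
    using \<gamma> unfolding bounded_functionals_def by blast
  \<comment> \<open>A nonnegative radius puts the base point into the inner region, so the glued
    function vanishes there and normalization does not alter it.\<close>
  define R where "R = max S 0"
  \<comment> \<open>The cross difference is at most \<open>dist y z + 2 * R\<close>, and
    \<open>dist y z\<close> is at least \<open>T - R\<close>, so \<open>e * dist y z\<close> absorbs
    the excess. The extra 1 keeps T above R when R is 0.\<close>
  define T where "T = R + (2 * R + 1) / e"
  have R: "R \<ge> 0" "S \<le> R" by (auto simp: R_def)
  have T: "e * (T - R) = 2 * R + 1" using e by (simp add: T_def)
  have RT: "R < T" unfolding T_def using e R by (simp add: add_nonneg_pos)
  define k where "k y = (if dist y basepoint \<le> R then lip0_apply f y else lip0_apply g y)" for y
  have "(1 + e)-lipschitz_on ({y. dist y basepoint \<le> R} \<union> {y. T \<le> dist y basepoint}) k"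
  proof (rule lipschitz_on_Un)
    have "(1 + e)-lipschitz_on {y. dist y basepoint \<le> R} (lip0_apply f)"
      using f e by (intro lipschitz_on_mono[OF lip0_lipschitz]) auto
    then show "(1 + e)-lipschitz_on {y. dist y basepoint \<le> R} k"
      by (rule lipschitz_on_transform) (simp add: k_def)
    have "(1 + e)-lipschitz_on {y. T \<le> dist y basepoint} (lip0_apply g)"
      using g e by (intro lipschitz_on_mono[OF lip0_lipschitz]) auto
    then show "(1 + e)-lipschitz_on {y. T \<le> dist y basepoint} k"
      by (rule lipschitz_on_transform) (use RT in \<open>simp add: k_def\<close>)
    fix y z :: 'a assume "y \<in> {y. dist y basepoint \<le> R}" "z \<in> {y. T \<le> dist y basepoint}"
    then have y: "dist y basepoint \<le> R" and z: "T \<le> dist z basepoint" by auto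
    have "\<bar>lip0_apply f y\<bar> \<le> R"
      using abs_lip0_le[of f y] mult_right_mono[OF f, of "dist y basepoint"] y by simp
    moreover have "\<bar>lip0_apply g z\<bar> \<le> dist z basepoint"
      using abs_lip0_le[of g z] mult_right_mono[OF g, of "dist z basepoint"] by simp
    moreover have tri: "dist z basepoint \<le> dist y z + R"
      using y dist_triangle[of z basepoint y] by (simp add: dist_commute)
    moreover have "e * (T - R) \<le> e * dist y z"
      using tri z e by (intro mult_left_mono) auto
    ultimately have "\<bar>lip0_apply f y - lip0_apply g z\<bar> \<le> (1 + e) * dist y z"
      using T by (simp add: algebra_simps)
    then show "dist (k y) (k z) \<le> (1 + e) * dist y z"
      using y z RT by (simp add: k_def dist_real_def)
  qed
  then obtain l where l: "(1 + e)-lipschitz_on UNIV l"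
      "\<And>y. dist y basepoint \<le> R \<Longrightarrow> l y = k y" "\<And>y. T \<le> dist y basepoint \<Longrightarrow> l y = k y"
    by (rule lipschitz_extension) blast
  have l0: "l basepoint = 0" using l(2)[of basepoint] R by (simp add: k_def)
  have h: "lip0_apply (lip0_of l) y = l y" for y
    by (simp add: lip0_of_apply[OF l(1)] l0)
  show "\<exists>h. norm h \<le> 1 + e \<and> blinfun_apply \<gamma> h = blinfun_apply \<gamma> f \<and> blinfun_apply \<psi> h = blinfun_apply \<psi> g"
  proof (intro exI[of _ "lip0_of l"] conjI)
    show "norm (lip0_of l) \<le> 1 + e" by (rule norm_lip0_of[OF l(1)])
    have "blinfun_apply \<gamma> (lip0_of l - f) = 0"
      using R l(2) by (intro S) (auto simp: minus_lip0.rep_eq h k_def)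
    then show "blinfun_apply \<gamma> (lip0_of l) = blinfun_apply \<gamma> f" by (simp add: blinfun.diff_right)
    have "blinfun_apply \<psi> (lip0_of l - g) = 0"
      using RT l(3) by (intro concentrated_at_infinity_vanishes[OF \<psi>, of T]) (auto simp: minus_lip0.rep_eq h k_def)
    then show "blinfun_apply \<psi> (lip0_of l) = blinfun_apply \<psi> g" by (simp add: blinfun.diff_right)
  qed
qed

lemma norm_add_derivation:
  assumes \<psi>: "\<psi> \<in> functionals_off x" and \<delta>: "\<delta> \<in> derivations x"
  shows "norm (\<psi> + \<delta>) = norm \<psi> + norm \<delta>"
proof (rule norm_add_eqI)
  fix e :: real and f g :: "'a lip0"
  assume e: "e > 0" and f: "norm f \<le> 1" and g: "norm g \<le> 1"
  obtain r0 where r0: "r0 > 0"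
    "\<And>f. (\<forall>y. y = x \<or> r0 \<le> dist y x \<longrightarrow> lip0_apply f y = 0) \<Longrightarrow> blinfun_apply \<psi> f = 0"
    using \<psi> unfolding functionals_off_def by blast
  \<comment> \<open>Beyond radius r the glued function equals f; the second bound keeps the base
    point out of the gap, so normalization does not alter the function.\<close>
  define r where "r = (if x = basepoint then r0 else min r0 (dist basepoint x))"
  have r: "r > 0" "r \<le> r0" "basepoint = x \<or> r \<le> dist basepoint x"
    using r0 by (auto simp: r_def)
  \<comment> \<open>The solution of 2 * s = e * (r - s). Since the values at x match, the cross
    difference is at most \<open>dist y z + 2 * s\<close>, while \<open>dist y z\<close> is at least
    \<open>r - s\<close>.\<close>
  define s where "s = e * r / (2 + e)"
  have s: "s > 0" using e r by (simp add: s_def)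
  have "2 * s + e * s = s * (2 + e)" by (simp add: algebra_simps)
  also have "\<dots> = e * r" using e by (simp add: s_def)
  finally have sr: "2 * s = e * (r - s)" by (simp add: algebra_simps)
  then have "s < r" using s e zero_less_mult_pos[of e "r - s"] by simp
  define k where
    "k y = (if dist y x < s then lip0_apply g y - lip0_apply g x + lip0_apply f x else lip0_apply f y)" for y
  have "(1 + e)-lipschitz_on ({y. dist y x < s} \<union> {y. r \<le> dist y x}) k"
  proof (rule lipschitz_on_Un)
    have "(norm g)-lipschitz_on UNIV (\<lambda>y. lip0_apply g y - lip0_apply g x + lip0_apply f x)"
      by (rule lipschitz_onI) (use lipschitz_onD[OF lip0_lipschitz[of g]] in \<open>auto simp: dist_real_def\<close>)
    then have "(1 + e)-lipschitz_on {y. dist y x < s} (\<lambda>y. lip0_apply g y - lip0_apply g x + lip0_apply f x)"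
      using g e by (elim lipschitz_on_mono) auto
    then show "(1 + e)-lipschitz_on {y. dist y x < s} k"
      by (rule lipschitz_on_transform) (simp add: k_def)
    have "(1 + e)-lipschitz_on {y. r \<le> dist y x} (lip0_apply f)"
      using f e by (intro lipschitz_on_mono[OF lip0_lipschitz]) auto
    then show "(1 + e)-lipschitz_on {y. r \<le> dist y x} k"
      by (rule lipschitz_on_transform) (use \<open>s < r\<close> in \<open>simp add: k_def\<close>)
    fix y z :: 'a assume "y \<in> {y. dist y x < s}" "z \<in> {y. r \<le> dist y x}"
    then have y: "dist y x < s" and z: "r \<le> dist z x" by auto
    have "\<bar>lip0_apply g y - lip0_apply g x\<bar> \<le> s"
      using abs_lip0_diff_le[of g y x] mult_right_mono[OF g, of "dist y x"] y by simp
    moreover have "\<bar>lip0_apply f x - lip0_apply f z\<bar> \<le> dist z x"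
      using abs_lip0_diff_le[of f x z] mult_right_mono[OF f, of "dist x z"] by (simp add: dist_commute)
    moreover have tri: "dist z x \<le> dist y z + s"
      using y dist_triangle[of z x y] by (simp add: dist_commute)
    moreover have "e * (r - s) \<le> e * dist y z"
      using tri z e by (intro mult_left_mono) auto
    ultimately have "\<bar>lip0_apply g y - lip0_apply g x + lip0_apply f x - lip0_apply f z\<bar> \<le> (1 + e) * dist y z"
      using sr by (simp add: algebra_simps)
    then show "dist (k y) (k z) \<le> (1 + e) * dist y z"
      using y z \<open>s < r\<close> by (simp add: k_def dist_real_def)
  qed
  then obtain l where l: "(1 + e)-lipschitz_on UNIV l"
      "\<And>y. dist y x < s \<Longrightarrow> l y = k y" "\<And>y. r \<le> dist y x \<Longrightarrow> l y = k y"
    by (rule lipschitz_extension) blast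
  have lf: "l y = lip0_apply f y" if "y = x \<or> r \<le> dist y x" for y
    using that l(2)[of y] l(3)[of y] s \<open>s < r\<close> by (auto simp: k_def)
  have h: "lip0_apply (lip0_of l) y = l y" for y
    using lf[OF r(3)] by (simp add: lip0_of_apply[OF l(1)])
  show "\<exists>h. norm h \<le> 1 + e \<and> blinfun_apply \<psi> h = blinfun_apply \<psi> f \<and> blinfun_apply \<delta> h = blinfun_apply \<delta> g"
  proof (intro exI[of _ "lip0_of l"] conjI)
    show "norm (lip0_of l) \<le> 1 + e" by (rule norm_lip0_of[OF l(1)])
    have "blinfun_apply \<psi> (lip0_of l - f) = 0"
      using lf r(2) by (intro r0(2)) (auto simp: minus_lip0.rep_eq h)
    then show "blinfun_apply \<psi> (lip0_of l) = blinfun_apply \<psi> f" by (simp add: blinfun.diff_right)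
    show "blinfun_apply \<delta> (lip0_of l) = blinfun_apply \<delta> g"
    proof (rule derivation_at_eqI[OF _ s])
      show "derivation_at x \<delta>" using \<delta> by (simp add: derivations_def)
      show "lip0_apply (lip0_of l) y - lip0_apply g y = lip0_apply f x - lip0_apply g x" if "dist y x < s" for y
        using that l(2)[of y] by (simp add: h k_def)
    qed
  qed
qed

text \<open>The induction removes one derivation at a time: the other terms together lie in the
  subspace \<open>functionals_off x\<close>, so each step glues at a single point.\<close>

lemma norm_sum_components:
  assumes \<gamma>: "\<gamma> \<in> free_space" and \<psi>: "\<psi> \<in> concentrated_at_infinity"
    and P: "finite P" and \<delta>: "\<And>x. x \<in> P \<Longrightarrow> \<delta> x \<in> derivations x"
  shows "norm (\<gamma> + \<psi> + (\<Sum>x\<in>P. \<delta> x)) = norm \<gamma> + norm \<psi> + (\<Sum>x\<in>P. norm (\<delta> x))"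
proof -
  have span: "norm (\<gamma> + \<psi> + (\<Sum>x\<in>P. \<delta> x)) = norm \<gamma> + norm \<psi> + (\<Sum>x\<in>P. norm (\<delta> x))"
    if \<gamma>: "\<gamma> \<in> span (range eval_functional)" for \<gamma>
    using P \<delta>
  proof (induction P rule: finite_induct)
    case empty
    then show ?case
      using norm_add_concentrated_at_infinity[OF _ \<psi>] \<gamma> span_eval_subset_bounded_functionals by auto
  next
    case (insert x P)
    have "\<gamma> + \<psi> + (\<Sum>y\<in>P. \<delta> y) \<in> functionals_off x"
    proof (intro subspace_add subspace_sum subspace_functionals_off)
      show "\<gamma> \<in> functionals_off x"
        using \<gamma> span_eval_subset_functionals_off by blast
      show "\<psi> \<in> functionals_off x"
        using \<psi> concentrated_at_infinity_subset_functionals_off by blast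
      show "\<delta> y \<in> functionals_off x" if "y \<in> P" for y
      proof -
        have "x \<noteq> y" using insert.hyps(2) that by blast
        from derivations_subset_functionals_off[OF this] show ?thesis
          using insert.prems that by blast
      qed
    qed
    from norm_add_derivation[OF this insert.prems[of x]]
    have "norm (\<gamma> + \<psi> + (\<Sum>y\<in>P. \<delta> y) + \<delta> x) = norm (\<gamma> + \<psi> + (\<Sum>y\<in>P. \<delta> y)) + norm (\<delta> x)"
      by simp
    moreover have "norm (\<gamma> + \<psi> + (\<Sum>y\<in>P. \<delta> y)) = norm \<gamma> + norm \<psi> + (\<Sum>y\<in>P. norm (\<delta> y))"
      using insert.IH insert.prems by simp
    ultimately show ?case
      using insert.hyps by (simp add: add_ac)
  qed
  have "closed {\<gamma>. norm (\<gamma> + \<psi> + (\<Sum>x\<in>P. \<delta> x)) = norm \<gamma> + norm \<psi> + (\<Sum>x\<in>P. norm (\<delta> x))}"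
    by (intro closed_Collect_eq continuous_intros)
  then have "free_space \<subseteq> {\<gamma>. norm (\<gamma> + \<psi> + (\<Sum>x\<in>P. \<delta> x)) = norm \<gamma> + norm \<psi> + (\<Sum>x\<in>P. norm (\<delta> x))}"
    unfolding free_space_def using span by (intro closure_minimal) auto
  then show ?thesis using \<gamma> by blast
qed

subsection \<open>Localization\<close>

lemma lip0_of_zero [simp]: "lip0_of (\<lambda>y. 0) = 0"
  by (intro lip0_eqI) (simp add: lip0_of_apply[OF lipschitz_on_constant] zero_lip0.rep_eq)

text \<open>Where g is nonzero, f - f(x) is at most K * R. A bump of radius r has R = 2 * r and L =
  1 / r, so the resulting constant does not depend on the scale.\<close>

lemma lipschitz_on_diff_mult:
  fixes f g :: "'a::metric_space \<Rightarrow> real"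
  assumes f: "K-lipschitz_on UNIV f" and g: "L-lipschitz_on UNIV g"
    and B: "\<And>y. \<bar>g y\<bar> \<le> B" and R: "0 \<le> R" "\<And>y. R < dist y x \<Longrightarrow> g y = 0"
  shows "(K * (R * L + B))-lipschitz_on UNIV (\<lambda>y. (f y - f x) * g y)"
proof (rule lipschitz_onI)
  have K: "0 \<le> K" and L: "0 \<le> L" using f g by (auto dest: lipschitz_on_nonneg)
  have "0 \<le> B" using B[of x] by simp
  then show "0 \<le> K * (R * L + B)" using K L R by simp
  have main: "\<bar>(f y - f x) * g y - (f z - f x) * g z\<bar> \<le> K * (R * L + B) * dist y z"
    if y: "dist y x \<le> R" for y z
  proof -
    have "\<bar>f y - f x\<bar> \<le> K * dist y x"
      using lipschitz_onD[OF f, of y x] by (simp add: dist_real_def)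
    also have "\<dots> \<le> K * R" using y K by (rule mult_left_mono)
    finally have "\<bar>f y - f x\<bar> * \<bar>g y - g z\<bar> \<le> (K * R) * (L * dist y z)"
      using lipschitz_onD[OF g, of y z] K R by (intro mult_mono) (auto simp: dist_real_def)
    then have 1: "\<bar>(f y - f x) * (g y - g z)\<bar> \<le> (K * R) * (L * dist y z)"
      by (simp add: abs_mult)
    have "\<bar>f y - f z\<bar> * \<bar>g z\<bar> \<le> (K * dist y z) * B"
      using lipschitz_onD[OF f, of y z] K B by (intro mult_mono) (auto simp: dist_real_def)
    then have 2: "\<bar>(f y - f z) * g z\<bar> \<le> (K * dist y z) * B"
      by (simp add: abs_mult)
    have "(f y - f x) * g y - (f z - f x) * g z = (f y - f x) * (g y - g z) + (f y - f z) * g z"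
      by (simp add: algebra_simps)
    moreover have "K * (R * L + B) * dist y z = (K * R) * (L * dist y z) + (K * dist y z) * B"
      by (simp add: algebra_simps)
    ultimately show ?thesis using 1 2 by linarith
  qed
  fix y z
  show "dist ((f y - f x) * g y) ((f z - f x) * g z) \<le> K * (R * L + B) * dist y z"
  proof (cases "dist y x \<le> R \<or> dist z x \<le> R")
    case True
    then show ?thesis
      using main[of y z] main[of z y] by (auto simp: dist_real_def dist_commute abs_minus_commute)
  next
    case False
    then show ?thesis using R(2) \<open>0 \<le> K * (R * L + B)\<close> by simp
  qed
qed

text \<open>Weights for which multiplying f - f(x) by g is a bounded operation whatever the centre
  x, so that weights can be moved between centres.\<close>

definition test_function :: "('a::pointed_metric_space \<Rightarrow> real) \<Rightarrow> bool"
  where "test_function g \<longleftrightarrow> (\<exists>L. L-lipschitz_on UNIV g) \<and> (\<exists>B. \<forall>y. \<bar>g y\<bar> \<le> B) \<and>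
    (\<exists>R. \<forall>y. R < dist y basepoint \<longrightarrow> g y = 0)"

lemma test_function_mult:
  assumes g: "test_function g" and c: "L-lipschitz_on UNIV c" "\<And>y. \<bar>c y\<bar> \<le> 1"
  shows "test_function (\<lambda>y. g y * c y)"
proof -
  obtain M B R where M: "M-lipschitz_on UNIV g" and B: "\<And>y. \<bar>g y\<bar> \<le> B"
      and R: "\<And>y. R < dist y basepoint \<Longrightarrow> g y = 0"
    using g unfolding test_function_def by blast
  have "0 \<le> B" using B[of basepoint] by simp
  have "(B * L + M)-lipschitz_on UNIV (\<lambda>y. g y * c y)"
  proof (rule lipschitz_onI)
    show "0 \<le> B * L + M"
      using \<open>0 \<le> B\<close> lipschitz_on_nonneg[OF c(1)] lipschitz_on_nonneg[OF M] by simp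
    fix y z
    have "\<bar>g y\<bar> * \<bar>c y - c z\<bar> \<le> B * (L * dist y z)"
      using B lipschitz_onD[OF c(1), of y z] \<open>0 \<le> B\<close> by (intro mult_mono) (auto simp: dist_real_def)
    then have 1: "\<bar>g y * (c y - c z)\<bar> \<le> B * (L * dist y z)" by (simp add: abs_mult)
    have "\<bar>g y - g z\<bar> * \<bar>c z\<bar> \<le> (M * dist y z) * 1"
      using c(2) lipschitz_onD[OF M, of y z] lipschitz_on_nonneg[OF M]
      by (intro mult_mono) (auto simp: dist_real_def)
    then have 2: "\<bar>(g y - g z) * c z\<bar> \<le> M * dist y z" by (simp add: abs_mult)
    have "g y * c y - g z * c z = g y * (c y - c z) + (g y - g z) * c z"
      by (simp add: algebra_simps)
    then show "dist (g y * c y) (g z * c z) \<le> (B * L + M) * dist y z"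
      using 1 2 by (simp add: dist_real_def algebra_simps)
  qed
  moreover have "\<bar>g y * c y\<bar> \<le> B" for y
    using mult_mono[OF B[of y] c(2)[of y]] \<open>0 \<le> B\<close> by (simp add: abs_mult)
  ultimately show ?thesis
    unfolding test_function_def using R by (metis mult_zero_left)
qed

lemma test_functionE:
  assumes "test_function g"
  obtains C where "\<And>f. (norm f * C)-lipschitz_on UNIV (\<lambda>y. (lip0_apply f y - lip0_apply f x) * g y)"
proof -
  obtain L B R where L: "L-lipschitz_on UNIV g" and B: "\<And>y. \<bar>g y\<bar> \<le> B"
      and R: "\<And>y. R < dist y basepoint \<Longrightarrow> g y = 0"
    using assms unfolding test_function_def by blast
  define S where "S = max R 0 + dist x basepoint"
  have "g y = 0" if "S < dist y x" for y
  proof (rule R)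
    show "R < dist y basepoint"
      using that dist_triangle[of y x basepoint] by (simp add: S_def dist_commute)
  qed
  then have "(norm f * (S * L + B))-lipschitz_on UNIV (\<lambda>y. (lip0_apply f y - lip0_apply f x) * g y)" for f
    by (intro lipschitz_on_diff_mult lip0_lipschitz L B) (auto simp: S_def)
  then show ?thesis by (rule that)
qed

text \<open>Subtracting \<^term>\<open>lip0_apply f x\<close> keeps the norm of the product bounded uniformly over cutoff
  functions at scales shrinking to \<^term>\<open>x\<close>; for \<^term>\<open>x = basepoint\<close> this is the weighting
  operator with weight \<^term>\<open>g\<close>.\<close>

definition localize :: "'a::pointed_metric_space \<Rightarrow> ('a \<Rightarrow> real) \<Rightarrow> 'a lip0 \<Rightarrow>\<^sub>L 'a lip0"
  where "localize x g = Blinfun (\<lambda>f. lip0_of (\<lambda>y. (lip0_apply f y - lip0_apply f x) * g y))"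

lemma localize_apply:
  assumes "test_function g"
  shows "blinfun_apply (localize x g) f = lip0_of (\<lambda>y. (lip0_apply f y - lip0_apply f x) * g y)"
proof -
  obtain C where C: "\<And>f. (norm f * C)-lipschitz_on UNIV (\<lambda>y. (lip0_apply f y - lip0_apply f x) * g y)"
    by (rule test_functionE[OF assms, of x]) blast
  have "bounded_linear (\<lambda>f. lip0_of (\<lambda>y. (lip0_apply f y - lip0_apply f x) * g y))"
  proof (rule bounded_linear_intro)
    show "norm (lip0_of (\<lambda>y. (lip0_apply f y - lip0_apply f x) * g y)) \<le> norm f * C" for f
      by (rule norm_lip0_of[OF C])
  qed (rule lip0_eqI, simp only: lip0_of_apply[OF C],
      simp only: plus_lip0.rep_eq scaleR_lip0.rep_eq lip0_of_apply[OF C], simp add: algebra_simps)+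
  then show ?thesis
    unfolding localize_def by (simp add: bounded_linear_Blinfun_apply)
qed

text \<open>The last term is the normalization constant: at the base point the product equals
  \<open>- lip0_apply f x * g basepoint\<close>.\<close>

lemma localize_eval:
  assumes "test_function g"
  shows "lip0_apply (blinfun_apply (localize x g) f) y =
    (lip0_apply f y - lip0_apply f x) * g y + lip0_apply f x * g basepoint"
proof -
  obtain C where C: "\<And>f. (norm f * C)-lipschitz_on UNIV (\<lambda>y. (lip0_apply f y - lip0_apply f x) * g y)"
    by (rule test_functionE[OF assms, of x]) blast
  show ?thesis
    by (simp add: localize_apply[OF assms] lip0_of_apply[OF C])
qed

lemma localize_zero: "localize x (\<lambda>y. 0) = 0"
proof (rule blinfun_eqI)
  have "test_function (\<lambda>y. 0 :: real)"
    unfolding test_function_def by (auto intro: lipschitz_on_constant)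
  from localize_apply[OF this, of x] show "blinfun_apply (localize x (\<lambda>y. 0)) f = blinfun_apply 0 f" for f
    by (simp add: blinfun.zero_left)
qed

lemma localize_add:
  assumes "test_function g" "test_function h" "test_function (\<lambda>y. g y + h y)"
  shows "localize x (\<lambda>y. g y + h y) = localize x g + localize x h"
  by (intro blinfun_eqI lip0_eqI)
    (simp add: localize_eval assms blinfun.add_left plus_lip0.rep_eq algebra_simps)

text \<open>Normalization constants cancel: the inner operator multiplies differences from the value
  at x by g, and the outer operator sees only these differences.\<close>

lemma localize_comp:
  assumes "test_function g" "test_function h" "test_function (\<lambda>y. g y * h y)"
  shows "localize x h o\<^sub>L localize x g = localize x (\<lambda>y. g y * h y)"
  by (intro blinfun_eqI lip0_eqI) (simp add: localize_eval assms algebra_simps)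

text \<open>From f * g = (f - f(x)) * g + f(x) * g: changing the centre costs only a multiple of an
  evaluation, so membership in a subspace containing the evaluations is unaffected.\<close>

lemma localize_basepoint:
  assumes "test_function g"
  shows "\<phi> o\<^sub>L localize basepoint g =
    (\<phi> o\<^sub>L localize x g) + blinfun_apply \<phi> (lip0_of g) *\<^sub>R eval_functional x"
proof (rule blinfun_eqI)
  fix f
  obtain L where L: "L-lipschitz_on UNIV g" using assms unfolding test_function_def by blast
  have "localize basepoint g f = localize x g f + lip0_apply f x *\<^sub>R lip0_of g"
    by (intro lip0_eqI)
      (simp add: localize_eval assms plus_lip0.rep_eq scaleR_lip0.rep_eq lip0_of_apply[OF L] algebra_simps)
  then show "blinfun_apply (\<phi> o\<^sub>L localize basepoint g) f =
      blinfun_apply ((\<phi> o\<^sub>L localize x g) + blinfun_apply \<phi> (lip0_of g) *\<^sub>R eval_functional x) f"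
    by (simp add: blinfun.add_left blinfun.add_right blinfun.scaleR_left blinfun.scaleR_right
        eval_functional.rep_eq)
qed

lemma derivation_localize:
  assumes "\<delta> \<in> derivations x" "test_function g"
  shows "\<delta> o\<^sub>L localize x g \<in> derivations x"
  unfolding derivations_def derivation_at_def
proof (intro CollectI allI impI)
  fix f assume "\<exists>c. \<forall>\<^sub>F y in nhds x. lip0_apply f y = c"
  then obtain c r where r: "r > 0" "\<And>y. dist y x < r \<Longrightarrow> lip0_apply f y = c"
    unfolding eventually_nhds_metric by blast
  have "blinfun_apply \<delta> (localize x g f) = blinfun_apply \<delta> 0"
  proof (rule derivation_at_eqI[OF _ r(1)])
    show "derivation_at x \<delta>" using assms by (simp add: derivations_def)
    show "lip0_apply (localize x g f) y - lip0_apply 0 y = c * g basepoint" if "dist y x < r" for y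
      using r(2)[OF that] r(2)[of x] r(1) by (simp add: localize_eval assms zero_lip0.rep_eq)
  qed
  then show "blinfun_apply (\<delta> o\<^sub>L localize x g) f = 0" by (simp add: blinfun.zero_right)
qed

section \<open>Bump functions and gliding humps\<close>

definition bump :: "'a::metric_space \<Rightarrow> real \<Rightarrow> 'a \<Rightarrow> real"
  where "bump x r y = max 0 (min 1 (2 - dist y x / r))"

lemma bump_bounds: "0 \<le> bump x r y" "bump x r y \<le> 1"
  by (simp_all add: bump_def)

lemma bump_eq_1: "r > 0 \<Longrightarrow> dist y x \<le> r \<Longrightarrow> bump x r y = 1"
  by (simp add: bump_def field_simps)

lemma bump_eq_0: "r > 0 \<Longrightarrow> 2 * r \<le> dist y x \<Longrightarrow> bump x r y = 0"
  by (simp add: bump_def field_simps)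

lemma lipschitz_bump:
  assumes "r > 0"
  shows "(1 / r)-lipschitz_on UNIV (bump x r)"
proof (rule lipschitz_onI)
  fix y z
  have "\<bar>bump x r y - bump x r z\<bar> \<le> \<bar>dist y x / r - dist z x / r\<bar>"
    unfolding bump_def by linarith
  also have "\<dots> = \<bar>dist y x - dist z x\<bar> / r"
    using assms by (simp flip: diff_divide_distrib)
  also have "\<dots> \<le> dist y z / r"
    using assms abs_dist_diff_le[of y x z] by (simp add: divide_right_mono dist_commute)
  finally show "dist (bump x r y) (bump x r z) \<le> 1 / r * dist y z"
    by (simp add: dist_real_def)
qed (use assms in simp)

lemma lipschitz_one_minus_bump:
  assumes "r > 0"
  shows "(1 / r)-lipschitz_on UNIV (\<lambda>y. 1 - bump x r y)"
  using lipschitz_on_diff[OF lipschitz_on_constant lipschitz_bump[OF assms], of 1 x] by simp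

lemma abs_bump_le: "\<bar>bump x r y\<bar> \<le> 1" "\<bar>1 - bump x r y\<bar> \<le> 1"
  using bump_bounds[of x r y] by auto

lemma test_function_bump:
  fixes x :: "'a::pointed_metric_space"
  assumes "r > 0"
  shows "test_function (bump x r)"
proof -
  have "bump x r y = 0" if "2 * r + dist x basepoint < dist y basepoint" for y
    using that dist_triangle[of y basepoint x] by (intro bump_eq_0 assms) simp
  then show ?thesis
    unfolding test_function_def using lipschitz_bump[OF assms] abs_bump_le(1) by blast
qed

lemma cutoff_op_eq_localize: "cutoff_op n = localize basepoint (bump basepoint (2 powi n))"
proof (intro blinfun_eqI lip0_eqI)
  fix f :: "'a lip0" and y :: 'a
  have "cutoff n y = bump basepoint (2 powi n) y"
    by (simp add: cutoff_alt bump_def power_int_minus divide_inverse mult.commute)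
  then show "lip0_apply (cutoff_op n f) y = lip0_apply (localize basepoint (bump basepoint (2 powi n)) f) y"
    by (simp add: cutoff_op.rep_eq cutoff_mult.rep_eq localize_eval test_function_bump)
qed

text \<open>The linear bound by the distance to x is the invariant that makes repetition possible.
  For y outside radius s and z inside radius t, the distances to x are at most
  \<open>2 * dist y z\<close> and \<open>dist y z\<close>, which is the origin of the factor 3. For
  other pairs only one of the two functions matters. Hence a further hump changes neither the
  constant 3 * k nor the linear bound.\<close>

lemma lipschitz_separated_add:
  fixes u v :: "'a::metric_space \<Rightarrow> real"
  assumes u: "(3 * k)-lipschitz_on UNIV u" "\<And>y. \<bar>u y\<bar> \<le> k * dist y x" "\<And>y. dist y x < s \<Longrightarrow> u y = 0"
    and v: "(3 * k)-lipschitz_on UNIV v" "\<And>y. \<bar>v y\<bar> \<le> k * dist y x" "\<And>y. t < dist y x \<Longrightarrow> v y = 0"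
    and st: "0 < t" "2 * t \<le> s"
  shows "(3 * k)-lipschitz_on UNIV (\<lambda>y. u y + v y)" "\<bar>u y + v y\<bar> \<le> k * dist y x"
proof -
  have k: "0 \<le> k" using lipschitz_on_nonneg[OF u(1)] by simp
  have main: "\<bar>(u y + v y) - (u z + v z)\<bar> \<le> 3 * k * dist y z" if le: "dist z x \<le> dist y x" for y z
  proof -
    consider "dist y x < s" | "s \<le> dist y x" "dist z x \<le> t" | "s \<le> dist y x" "t < dist z x"
      by linarith
    then show ?thesis
    proof cases
      case 1
      then have "u y = 0" "u z = 0" using u(3) le by auto
      then show ?thesis using lipschitz_onD[OF v(1), of y z] by (simp add: dist_real_def)
    next
      case 2
      then have "u z = 0" "v y = 0" using u(3) v(3) st by auto
      then have "\<bar>(u y + v y) - (u z + v z)\<bar> \<le> k * dist y x + k * dist z x"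
        using u(2)[of y] v(2)[of z] by auto
      also have "\<dots> = k * (dist y x + dist z x)" by (simp add: algebra_simps)
      also have "\<dots> \<le> k * (3 * dist y z)"
        using 2 st dist_triangle[of y x z] by (intro mult_left_mono k) auto
      finally show ?thesis by (simp add: algebra_simps)
    next
      case 3
      then have "v y = 0" "v z = 0" using v(3) le st by auto
      then show ?thesis using lipschitz_onD[OF u(1), of y z] by (simp add: dist_real_def)
    qed
  qed
  show "(3 * k)-lipschitz_on UNIV (\<lambda>y. u y + v y)"
  proof (rule lipschitz_onI)
    show "dist (u y + v y) (u z + v z) \<le> 3 * k * dist y z" for y z
      using main[of y z] main[of z y]
      by (cases "dist z x \<le> dist y x") (auto simp: dist_real_def dist_commute abs_minus_commute)
  qed (use k in simp)
  show "\<bar>u y + v y\<bar> \<le> k * dist y x"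
    using u(2)[of y] v(2)[of y] u(3)[of y] v(3)[of y] st by (cases "dist y x < s") auto
qed

text \<open>A positive inner radius forces u x = 0, which turns the Lipschitz estimate into the
  linear bound.\<close>

lemma lipschitz_annulus:
  fixes u :: "'a::metric_space \<Rightarrow> real"
  assumes "k-lipschitz_on UNIV u" "\<And>y. dist y x < a \<Longrightarrow> u y = 0" "0 < a"
  shows "(3 * k)-lipschitz_on UNIV u" "\<bar>u y\<bar> \<le> k * dist y x"
proof -
  show "(3 * k)-lipschitz_on UNIV u"
    using assms(1) lipschitz_on_nonneg[OF assms(1)] by (intro lipschitz_on_mono[OF assms(1)]) auto
  show "\<bar>u y\<bar> \<le> k * dist y x"
    using lipschitz_onD[OF assms(1), of y x] assms(2)[of x] assms(3) by (simp add: dist_real_def)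
qed

lemma not_unbounded_on_lipschitz:
  fixes \<phi> :: "'a::pointed_metric_space lip0_dual"
  assumes e: "0 < e"
    and ex: "\<And>N::nat. \<exists>u. K-lipschitz_on UNIV u \<and> N * e \<le> blinfun_apply \<phi> (lip0_of u)"
  shows False
proof -
  obtain N :: nat where N: "norm \<phi> * K < N * e"
    using reals_Archimedean3[OF e] by (auto simp: mult.commute)
  obtain u where u: "K-lipschitz_on UNIV u" "N * e \<le> blinfun_apply \<phi> (lip0_of u)"
    using ex[of N] by blast
  have "blinfun_apply \<phi> (lip0_of u) \<le> norm \<phi> * norm (lip0_of u)"
    using norm_blinfun[of \<phi> "lip0_of u"] by simp
  also have "\<dots> \<le> norm \<phi> * K" using norm_lip0_of[OF u(1)] by (intro mult_left_mono) auto
  finally show False using u(2) N by simp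
qed

text \<open>Gliding hump: bumps on widely separated annuli can be added at the cost of a factor 3 in the
  Lipschitz constant, so a bounded functional cannot be large on infinitely many of them.\<close>

lemma small_on_small_annuli:
  fixes \<phi> :: "'a::pointed_metric_space lip0_dual"
  assumes e: "0 < e"
  shows "\<exists>r>0. \<forall>a b u. 0 < a \<and> b \<le> r \<and> k-lipschitz_on UNIV u \<and>
    (\<forall>y. dist y x < a \<or> b < dist y x \<longrightarrow> u y = 0) \<longrightarrow> blinfun_apply \<phi> (lip0_of u) < e"
proof (rule ccontr)
  assume "\<not> ?thesis"
  then have bad: "\<exists>a b u. 0 < a \<and> b \<le> r \<and> k-lipschitz_on UNIV u \<and>
      (\<forall>y. dist y x < a \<or> b < dist y x \<longrightarrow> u y = 0) \<and> e \<le> blinfun_apply \<phi> (lip0_of u)" if "0 < r" for r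
    using that by (meson not_less)
  have k: "0 \<le> k" using bad[of 1] lipschitz_on_nonneg by fastforce
  have "\<exists>s u. 0 < s \<and> (3 * k)-lipschitz_on UNIV u \<and> (\<forall>y. \<bar>u y\<bar> \<le> k * dist y x) \<and>
      (\<forall>y. dist y x < s \<longrightarrow> u y = 0) \<and> real N * e \<le> blinfun_apply \<phi> (lip0_of u)" for N
  proof (induction N)
    case 0
    show ?case
      using k by (intro exI[of _ 1] exI[of _ "\<lambda>_. 0"])
        (auto simp: blinfun.zero_right intro: lipschitz_on_mono[OF lipschitz_on_constant])
  next
    case (Suc N)
    then obtain s u where s: "0 < s" and u: "(3 * k)-lipschitz_on UNIV u" "\<And>y. \<bar>u y\<bar> \<le> k * dist y x"
        "\<And>y. dist y x < s \<Longrightarrow> u y = 0" and N: "real N * e \<le> blinfun_apply \<phi> (lip0_of u)"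
      by blast
    \<comment> \<open>Half the inner radius meets the separation required for addition, and a > 0
      leaves a hole around x for the next hump.\<close>
    obtain a b v where a: "0 < a" "b \<le> s / 2" and v: "k-lipschitz_on UNIV v"
        "\<And>y. dist y x < a \<or> b < dist y x \<Longrightarrow> v y = 0" "e \<le> blinfun_apply \<phi> (lip0_of v)"
      using bad[of "s / 2"] s by auto
    have v': "(3 * k)-lipschitz_on UNIV v" "\<bar>v y\<bar> \<le> k * dist y x" "s / 2 < dist y x \<Longrightarrow> v y = 0" for y
      using lipschitz_annulus[OF v(1) _ a(1)] v(2) a(2) by auto
    have "real (Suc N) * e \<le> blinfun_apply \<phi> (lip0_of (\<lambda>y. u y + v y))"
      using N v(3) by (simp add: lip0_of_add[OF u(1) v(1)] blinfun.add_right distrib_right)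
    then show ?case
      using lipschitz_separated_add[where s = s and t = "s / 2", OF u v'] s a u(3) v(2)
      by (intro exI[of _ "min s a"] exI[of _ "\<lambda>y. u y + v y"]) auto
  qed
  then show False by (intro not_unbounded_on_lipschitz[OF e]) blast
qed

text \<open>The hump now moves outwards: the accumulated sum lives within radius s and each new hump
  beyond 2 * s. The outer radius b keeps the new sum boundedly supported, so the construction can
  continue.\<close>

lemma small_on_large_annuli:
  fixes \<phi> :: "'a::pointed_metric_space lip0_dual"
  assumes e: "0 < e"
  shows "\<exists>r>0. \<forall>a b u. r \<le> a \<and> k-lipschitz_on UNIV u \<and>
    (\<forall>y. dist y x < a \<or> b < dist y x \<longrightarrow> u y = 0) \<longrightarrow> blinfun_apply \<phi> (lip0_of u) < e"
proof (rule ccontr)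
  assume "\<not> ?thesis"
  then have bad: "\<exists>a b u. r \<le> a \<and> k-lipschitz_on UNIV u \<and>
      (\<forall>y. dist y x < a \<or> b < dist y x \<longrightarrow> u y = 0) \<and> e \<le> blinfun_apply \<phi> (lip0_of u)" if "0 < r" for r
    using that by (meson not_less)
  have k: "0 \<le> k" using bad[of 1] lipschitz_on_nonneg by fastforce
  have "\<exists>s u. 0 < s \<and> (3 * k)-lipschitz_on UNIV u \<and> (\<forall>y. \<bar>u y\<bar> \<le> k * dist y x) \<and>
      (\<forall>y. s < dist y x \<longrightarrow> u y = 0) \<and> real N * e \<le> blinfun_apply \<phi> (lip0_of u)" for N
  proof (induction N)
    case 0
    show ?case
      using k by (intro exI[of _ 1] exI[of _ "\<lambda>_. 0"])
        (auto simp: blinfun.zero_right intro: lipschitz_on_mono[OF lipschitz_on_constant])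
  next
    case (Suc N)
    then obtain s u where s: "0 < s" and u: "(3 * k)-lipschitz_on UNIV u" "\<And>y. \<bar>u y\<bar> \<le> k * dist y x"
        "\<And>y. s < dist y x \<Longrightarrow> u y = 0" and N: "real N * e \<le> blinfun_apply \<phi> (lip0_of u)"
      by blast
    obtain a b v where a: "2 * s \<le> a" and v: "k-lipschitz_on UNIV v"
        "\<And>y. dist y x < a \<or> b < dist y x \<Longrightarrow> v y = 0" "e \<le> blinfun_apply \<phi> (lip0_of v)"
      using bad[of "2 * s"] s by auto
    have "0 < a" using a s by simp
    have v': "(3 * k)-lipschitz_on UNIV v" "\<bar>v y\<bar> \<le> k * dist y x" "dist y x < a \<Longrightarrow> v y = 0" for y
      using lipschitz_annulus[OF v(1) _ \<open>0 < a\<close>] v(2) by auto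
    have "real (Suc N) * e \<le> blinfun_apply \<phi> (lip0_of (\<lambda>y. v y + u y))"
      using N v(3) by (simp add: lip0_of_add[OF v(1) u(1)] blinfun.add_right distrib_right)
    then show ?case
      using lipschitz_separated_add[where s = a and t = s, OF v' u s a] s u(3) v(2)
      by (intro exI[of _ "max s b"] exI[of _ "\<lambda>y. v y + u y"]) auto
  qed
  then show False by (intro not_unbounded_on_lipschitz[OF e]) blast
qed

text \<open>Two bumps agree inside the smaller radius and beyond twice the larger, so the difference
  of two localizations of f lives on an annulus. For f in the unit ball each product has Lipschitz
  constant at most 2 + 1 at every scale, whence the 6. Shrinking and growing radii are covered
  together.\<close>

lemma convergent_localize_bump:
  fixes \<phi> :: "'a::pointed_metric_space lip0_dual" and \<rho> :: "nat \<Rightarrow> real"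
  assumes \<rho>: "\<And>n. 0 < \<rho> n"
    and small: "\<And>e. 0 < e \<Longrightarrow> \<exists>N. \<forall>m\<ge>N. \<forall>n\<ge>N. \<forall>u. 6-lipschitz_on UNIV u \<longrightarrow>
      (\<forall>y. dist y x < min (\<rho> m) (\<rho> n) \<or> 2 * max (\<rho> m) (\<rho> n) < dist y x \<longrightarrow> u y = 0) \<longrightarrow>
      blinfun_apply \<phi> (lip0_of u) < e"
  shows "convergent (\<lambda>n. \<phi> o\<^sub>L localize x (bump x (\<rho> n)))"
proof (rule Cauchy_convergent, rule CauchyI)
  fix e :: real assume e: "0 < e"
  then have "0 < e / 2" by simp
  from small[OF this] obtain N where N: "\<And>m n u. m \<ge> N \<Longrightarrow> n \<ge> N \<Longrightarrow> 6-lipschitz_on UNIV u \<Longrightarrow>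
      (\<forall>y. dist y x < min (\<rho> m) (\<rho> n) \<or> 2 * max (\<rho> m) (\<rho> n) < dist y x \<longrightarrow> u y = 0) \<Longrightarrow>
      blinfun_apply \<phi> (lip0_of u) < e / 2"
    by blast
  have "norm ((\<phi> o\<^sub>L localize x (bump x (\<rho> m))) - (\<phi> o\<^sub>L localize x (bump x (\<rho> n)))) \<le> e / 2"
    if mn: "m \<ge> N" "n \<ge> N" for m n
  proof (rule norm_blinfun_leI)
    fix f :: "'a lip0" assume f: "norm f \<le> 1"
    define F where "F k y = (lip0_apply f y - lip0_apply f x) * bump x (\<rho> k) y" for k y
    have F: "3-lipschitz_on UNIV (F k)" for k
    proof -
      have "(norm f * (2 * \<rho> k * (1 / \<rho> k) + 1))-lipschitz_on UNIV (F k)"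
        unfolding F_def
        by (intro lipschitz_on_diff_mult lip0_lipschitz lipschitz_bump abs_bump_le bump_eq_0 \<rho>)
          (use \<rho>[of k] in auto)
      then show ?thesis
        using \<rho>[of k] f by (elim lipschitz_on_mono) auto
    qed
    have u: "6-lipschitz_on UNIV (\<lambda>y. F m y - F n y)"
      using lipschitz_on_diff[OF F F, of m n] by simp
    have "blinfun_apply \<phi> (lip0_of (\<lambda>y. F m y - F n y)) < e / 2"
    proof (intro N[OF mn u] allI impI)
      fix y assume "dist y x < min (\<rho> m) (\<rho> n) \<or> 2 * max (\<rho> m) (\<rho> n) < dist y x"
      then have "bump x (\<rho> m) y = bump x (\<rho> n) y"
        using bump_eq_1[OF \<rho>[of m], of y x] bump_eq_1[OF \<rho>[of n], of y x]
          bump_eq_0[OF \<rho>[of m], of y x] bump_eq_0[OF \<rho>[of n], of y x] by auto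
      then show "F m y - F n y = 0" by (simp add: F_def)
    qed
    moreover have "lip0_of (\<lambda>y. F m y - F n y) = localize x (bump x (\<rho> m)) f - localize x (bump x (\<rho> n)) f"
      by (intro lip0_eqI)
        (simp add: lip0_of_apply[OF u] lip0_of_apply[OF F] localize_apply test_function_bump \<rho>
          minus_lip0.rep_eq flip: F_def)
    ultimately show "blinfun_apply ((\<phi> o\<^sub>L localize x (bump x (\<rho> m))) - (\<phi> o\<^sub>L localize x (bump x (\<rho> n)))) f \<le> e / 2"
      by (simp add: blinfun.diff_left blinfun.diff_right)
  qed
  then show "\<exists>M. \<forall>m\<ge>M. \<forall>n\<ge>M. norm ((\<phi> o\<^sub>L localize x (bump x (\<rho> m))) - (\<phi> o\<^sub>L localize x (bump x (\<rho> n)))) < e"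
    using e by (intro exI[of _ N]) fastforce
qed

text \<open>A function constant near x is sent to 0 by every localization at a sufficiently small
  scale, so the norm limit is a derivation.\<close>

lemma derivation_part:
  fixes \<phi> :: "'a::pointed_metric_space lip0_dual"
  obtains \<delta> where "\<delta> \<in> derivations x" "(\<lambda>n. \<phi> o\<^sub>L localize x (bump x ((1 / 2) ^ n))) \<longlonglongrightarrow> \<delta>"
proof -
  have "convergent (\<lambda>n. \<phi> o\<^sub>L localize x (bump x ((1 / 2) ^ n)))"
  proof (rule convergent_localize_bump)
    fix e :: real assume "0 < e"
    from small_on_small_annuli[OF this, of 6 x \<phi>] obtain r where r: "0 < r"
      "\<And>a b u. 0 < a \<Longrightarrow> b \<le> r \<Longrightarrow> 6-lipschitz_on UNIV u \<Longrightarrow>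
        (\<forall>y. dist y x < a \<or> b < dist y x \<longrightarrow> u y = 0) \<Longrightarrow> blinfun_apply \<phi> (lip0_of u) < e"
      by blast
    obtain N where N: "(1 / 2) ^ N < r / 2"
      using real_arch_pow_inv[of "r / 2" "1 / 2"] r by auto
    have half: "(1 / 2) ^ m \<le> r / 2" if "m \<ge> N" for m
      using power_decreasing[OF that, of "1 / 2 :: real"] N by linarith
    have small: "2 * max ((1 / 2) ^ m) ((1 / 2) ^ n) \<le> r" if "m \<ge> N" "n \<ge> N" for m n
      using half[OF that(1)] half[OF that(2)] by linarith
    show "\<exists>N. \<forall>m\<ge>N. \<forall>n\<ge>N. \<forall>u. 6-lipschitz_on UNIV u \<longrightarrow>
      (\<forall>y. dist y x < min ((1 / 2) ^ m) ((1 / 2) ^ n) \<or> 2 * max ((1 / 2) ^ m) ((1 / 2) ^ n) < dist y x \<longrightarrow> u y = 0) \<longrightarrow>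
      blinfun_apply \<phi> (lip0_of u) < e"
    proof (intro exI[of _ N] allI impI)
      fix m n and u :: "'a \<Rightarrow> real"
      assume "m \<ge> N" "n \<ge> N" "6-lipschitz_on UNIV u"
        "\<forall>y. dist y x < min ((1 / 2) ^ m) ((1 / 2) ^ n) \<or> 2 * max ((1 / 2) ^ m) ((1 / 2) ^ n) < dist y x \<longrightarrow> u y = 0"
      then show "blinfun_apply \<phi> (lip0_of u) < e"
        using small by (intro r(2)[of "min ((1 / 2) ^ m) ((1 / 2) ^ n)" "2 * max ((1 / 2) ^ m) ((1 / 2) ^ n)"]) auto
    qed
  qed simp
  then obtain \<delta> where \<delta>: "(\<lambda>n. \<phi> o\<^sub>L localize x (bump x ((1 / 2) ^ n))) \<longlonglongrightarrow> \<delta>"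
    by (auto simp: convergent_def)
  moreover have "\<delta> \<in> derivations x"
    unfolding derivations_def derivation_at_def
  proof (intro CollectI allI impI)
    fix f assume "\<exists>c. \<forall>\<^sub>F y in nhds x. lip0_apply f y = c"
    then obtain c r where r: "r > 0" "\<And>y. dist y x < r \<Longrightarrow> lip0_apply f y = c"
      unfolding eventually_nhds_metric by blast
    obtain N where N: "(1 / 2) ^ N < r / 2"
      using real_arch_pow_inv[of "r / 2" "1 / 2"] r by auto
    have "blinfun_apply (\<phi> o\<^sub>L localize x (bump x ((1 / 2) ^ n))) f = 0" if "n \<ge> N" for n
    proof -
      have n: "2 * (1 / 2) ^ n < r"
        using power_decreasing[OF that, of "1 / 2 :: real"] N by linarith
      have "(\<lambda>y. (lip0_apply f y - lip0_apply f x) * bump x ((1 / 2) ^ n) y) = (\<lambda>y. 0)"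
      proof
        fix y
        show "(lip0_apply f y - lip0_apply f x) * bump x ((1 / 2) ^ n) y = 0"
          using r(2)[of y] r(2)[of x] r(1) n bump_eq_0[of "(1 / 2) ^ n" y x]
          by (cases "dist y x < r") auto
      qed
      then show ?thesis
        by (simp add: localize_apply test_function_bump blinfun.zero_right)
    qed
    then have "(\<lambda>n. blinfun_apply (\<phi> o\<^sub>L localize x (bump x ((1 / 2) ^ n))) f) \<longlonglongrightarrow> 0"
      by (intro tendsto_eventually) (auto simp: eventually_sequentially)
    moreover have "(\<lambda>n. blinfun_apply (\<phi> o\<^sub>L localize x (bump x ((1 / 2) ^ n))) f) \<longlonglongrightarrow> blinfun_apply \<delta> f"
      by (intro blinfun.tendsto \<delta> tendsto_const)
    ultimately show "blinfun_apply \<delta> f = 0" by (rule LIMSEQ_unique[symmetric])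
  qed
  ultimately show ?thesis by (intro that)
qed

lemma part_at_infinity:
  fixes \<phi> :: "'a::pointed_metric_space lip0_dual"
  obtains \<psi> where "\<phi> - \<psi> \<in> concentrated_at_infinity" "(\<lambda>n. \<phi> o\<^sub>L cutoff_op (int n)) \<longlonglongrightarrow> \<psi>"
proof -
  have "convergent (\<lambda>n. \<phi> o\<^sub>L localize basepoint (bump basepoint (2 ^ n)))"
  proof (rule convergent_localize_bump)
    fix e :: real assume "0 < e"
    from small_on_large_annuli[OF this, of 6 basepoint \<phi>] obtain r where r: "0 < r"
      "\<And>a b u. r \<le> a \<Longrightarrow> 6-lipschitz_on UNIV u \<Longrightarrow>
        (\<forall>y. dist y basepoint < a \<or> b < dist y basepoint \<longrightarrow> u y = 0) \<Longrightarrow> blinfun_apply \<phi> (lip0_of u) < e"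
      by blast
    obtain N where N: "r < 2 ^ N" using real_arch_pow[of 2 r] by auto
    have le: "r \<le> 2 ^ m" if "m \<ge> N" for m
      using power_increasing[OF that, of "2 :: real"] N by linarith
    have large: "r \<le> min (2 ^ m) (2 ^ n)" if "m \<ge> N" "n \<ge> N" for m n
      using le[OF that(1)] le[OF that(2)] by simp
    show "\<exists>N. \<forall>m\<ge>N. \<forall>n\<ge>N. \<forall>u. 6-lipschitz_on UNIV u \<longrightarrow>
      (\<forall>y. dist y basepoint < min (2 ^ m) (2 ^ n) \<or> 2 * max (2 ^ m) (2 ^ n) < dist y basepoint \<longrightarrow> u y = 0) \<longrightarrow>
      blinfun_apply \<phi> (lip0_of u) < e"
    proof (intro exI[of _ N] allI impI)
      fix m n and u :: "'a \<Rightarrow> real"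
      assume "m \<ge> N" "n \<ge> N" "6-lipschitz_on UNIV u"
        "\<forall>y. dist y basepoint < min (2 ^ m) (2 ^ n) \<or> 2 * max (2 ^ m) (2 ^ n) < dist y basepoint \<longrightarrow> u y = 0"
      then show "blinfun_apply \<phi> (lip0_of u) < e"
        using large by (intro r(2)[of "min (2 ^ m) (2 ^ n)" u "2 * max (2 ^ m) (2 ^ n)"]) blast+
    qed
  qed simp
  then obtain \<psi> where \<psi>: "(\<lambda>n. \<phi> o\<^sub>L cutoff_op (int n)) \<longlonglongrightarrow> \<psi>"
    by (auto simp: convergent_def cutoff_op_eq_localize)
  moreover have "\<phi> - \<psi> \<in> concentrated_at_infinity"
    unfolding concentrated_at_infinity_def
  proof (intro CollectI allI blinfun_eqI)
    fix m :: int and f :: "'a lip0"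
    \<comment> \<open>Cutting off at scale m leaves a function supported within radius
      \<open>2 powi (m + 1)\<close>, where the cutoff at any scale n \<ge> m + 1 is 1. If m + 1 is
      negative, \<open>nat (m + 1)\<close> is 0, which is still large enough.\<close>
    have "blinfun_apply (\<phi> o\<^sub>L cutoff_op (int n)) (cutoff_op m f) = blinfun_apply \<phi> (cutoff_op m f)"
      if "n \<ge> nat (m + 1)" for n
    proof -
      have "cutoff_op (int n) (cutoff_op m f) = cutoff_op m f"
      proof (rule lip0_eqI)
        fix y :: 'a
        have "(2::real) powi (m + 1) \<le> 2 powi (int n)"
          using that by (intro power_int_increasing) auto
        moreover have "(2::real) powi m \<le> 2 powi (m + 1)"
          by (intro power_int_increasing) auto
        ultimately show "lip0_apply (cutoff_op (int n) (cutoff_op m f)) y = lip0_apply (cutoff_op m f) y"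
          by (auto simp: cutoff_op.rep_eq cutoff_mult.rep_eq cutoff_def)
      qed
      then show ?thesis by simp
    qed
    then have "(\<lambda>n. blinfun_apply (\<phi> o\<^sub>L cutoff_op (int n)) (cutoff_op m f)) \<longlonglongrightarrow> blinfun_apply \<phi> (cutoff_op m f)"
      by (intro tendsto_eventually) (auto simp: eventually_sequentially)
    moreover have "(\<lambda>n. blinfun_apply (\<phi> o\<^sub>L cutoff_op (int n)) (cutoff_op m f)) \<longlonglongrightarrow> blinfun_apply \<psi> (cutoff_op m f)"
      by (intro blinfun.tendsto \<psi> tendsto_const)
    ultimately have "blinfun_apply \<phi> (cutoff_op m f) = blinfun_apply \<psi> (cutoff_op m f)"
      by (rule LIMSEQ_unique)
    then show "blinfun_apply ((\<phi> - \<psi>) o\<^sub>L cutoff_op m) f = blinfun_apply 0 f"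
      by (simp add: blinfun.diff_left blinfun.zero_left)
  qed
  ultimately show ?thesis by (intro that)
qed

subsection \<open>Density of the sum\<close>

text \<open>A partition of unity built one ball at a time: the bump at x splits off a piece living
  in the doubled ball, and the rest vanishes on the ball itself, so the remaining balls carry
  it.\<close>

lemma localize_finite_cover:
  fixes \<phi> :: "'a::pointed_metric_space lip0_dual"
  assumes Z: "subspace Z" and "finite C"
    and r: "\<And>x. x \<in> C \<Longrightarrow> 0 < r x"
    and local: "\<And>x g. x \<in> C \<Longrightarrow> test_function g \<Longrightarrow> (\<And>y. 2 * r x \<le> dist y x \<Longrightarrow> g y = 0) \<Longrightarrow>
      \<phi> o\<^sub>L localize basepoint g \<in> Z"
    and g: "test_function g" "\<And>y. g y \<noteq> 0 \<Longrightarrow> \<exists>x\<in>C. dist y x < r x"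
  shows "\<phi> o\<^sub>L localize basepoint g \<in> Z"
  using \<open>finite C\<close> r local g
proof (induction C arbitrary: g rule: finite_induct)
  case empty
  then have "g = (\<lambda>y. 0)" by auto
  then show ?case using subspace_0[OF Z] by (simp add: localize_zero blinfun_compose_zero)
next
  case (insert x C)
  have rx: "0 < r x" using insert.prems(1) by simp
  let ?g1 = "\<lambda>y. g y * bump x (r x) y" and ?g2 = "\<lambda>y. g y * (1 - bump x (r x) y)"
  have test: "test_function ?g1" "test_function ?g2"
    by (rule test_function_mult[OF insert.prems(3) lipschitz_bump[OF rx] abs_bump_le(1)])
      (rule test_function_mult[OF insert.prems(3) lipschitz_one_minus_bump[OF rx] abs_bump_le(2)])
  have eq: "(\<lambda>y. ?g1 y + ?g2 y) = g" by (auto simp: algebra_simps)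
  have "localize basepoint g = localize basepoint ?g1 + localize basepoint ?g2"
    using localize_add[OF test, of basepoint] insert.prems(3) by (simp only: eq)
  moreover have "\<phi> o\<^sub>L localize basepoint ?g1 \<in> Z"
    using bump_eq_0[OF rx] by (intro insert.prems(2)[of x] test) auto
  moreover have "\<phi> o\<^sub>L localize basepoint ?g2 \<in> Z"
  proof (rule insert.IH)
    fix y assume y: "?g2 y \<noteq> 0"
    then have "\<not> dist y x < r x" using bump_eq_1[OF rx, of y x] by auto
    then show "\<exists>x\<in>C. dist y x < r x" using insert.prems(4)[of y] y by auto
  qed (use insert.prems test in auto)
  ultimately show ?case
    using subspace_add[OF Z] by (simp add: bounded_bilinear.add_right[OF bounded_bilinear_blinfun_compose])
qed

text \<open>The points without a neighbourhood on which \<^term>\<open>\<phi>\<close> is decomposable form a closed set, which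
  by Baire's theorem has an isolated point unless it is empty. Near such a point only the part of
  \<^term>\<open>\<phi>\<close> living at arbitrarily small scales is not covered by compactness, and that part
  converges to a derivation.\<close>

lemma decomposition_dense:
  fixes Z :: "'a::pointed_metric_space lip0_dual set"
  assumes countable: "countable (UNIV :: 'a set)"
    and proper: "\<And>(x :: 'a) r. compact (cball x r)"
    and Z: "subspace Z" "closed Z"
    and eval: "\<And>x. eval_functional x \<in> Z" and deriv: "\<And>x. derivations x \<subseteq> Z"
    and inf: "concentrated_at_infinity \<subseteq> Z"
  shows "\<phi> \<in> Z"
proof -
  \<comment> \<open>Goodness uses weights centred at the base point so that neighbourhoods of
    different points can be combined; \<open>base\<close> moves the centre to x when the scales
    around x are examined.\<close>
  define good where "good x r \<longleftrightarrow> 0 < r \<and> (\<forall>g. test_function g \<and> (\<forall>y. r \<le> dist y x \<longrightarrow> g y = 0) \<longrightarrow>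
    \<phi> o\<^sub>L localize basepoint g \<in> Z)" for x :: 'a and r
  define B where "B = {x. \<nexists>r. good x r}"
  have base: "\<phi> o\<^sub>L localize basepoint g \<in> Z \<longleftrightarrow> \<phi> o\<^sub>L localize x g \<in> Z" if "test_function g" for x g
    using subspace_add[OF Z(1)] subspace_diff[OF Z(1)] subspace_scale[OF Z(1) eval[of x]]
    by (simp add: localize_basepoint[OF that, of \<phi> x]) (metis add_diff_cancel_right')
  have compact_good: "\<phi> o\<^sub>L localize basepoint g \<in> Z"
    if K: "compact K" "K \<inter> B = {}" and g: "test_function g" "\<And>y. y \<notin> K \<Longrightarrow> g y = 0" for K g
  proof -
    have "\<forall>x\<in>K. \<exists>r. good x r" using K(2) by (auto simp: B_def)
    then obtain r where r: "\<And>x. x \<in> K \<Longrightarrow> good x (r x)" by metis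
    have "K \<subseteq> (\<Union>x\<in>K. ball x (r x / 2))" using r by (auto simp: good_def)
    then obtain C where C: "C \<subseteq> K" "finite C" "K \<subseteq> (\<Union>x\<in>C. ball x (r x / 2))"
      using compactE_image[OF K(1), of K "\<lambda>x. ball x (r x / 2)"] by auto
    \<comment> \<open>Half radii, because the bumps of the cover spread to twice the radius and must
      stay within \<open>r x\<close>.\<close>
    show ?thesis
    proof (rule localize_finite_cover[OF Z(1) C(2), where r = "\<lambda>x. r x / 2"])
      show "0 < r x / 2" if "x \<in> C" for x
        using r C(1) that by (auto simp: good_def)
      show "\<phi> o\<^sub>L localize basepoint h \<in> Z"
        if "x \<in> C" "test_function h" "\<And>y. 2 * (r x / 2) \<le> dist y x \<Longrightarrow> h y = 0" for x h
        using r[of x] C(1) that by (auto simp: good_def)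
      show "\<exists>x\<in>C. dist y x < r x / 2" if "g y \<noteq> 0" for y
        using C(3) g(2)[of y] that by (force simp: dist_commute)
    qed (rule g(1))
  qed
  have "B = {}"
  proof (rule ccontr)
    assume "B \<noteq> {}"
    have "open (- B)"
      unfolding open_dist
    proof
      fix x assume "x \<in> - B"
      then obtain r where r: "good x r" by (auto simp: B_def)
      have "good y (r / 2)" if y: "dist y x < r / 2" for y
        unfolding good_def
      proof (intro conjI allI impI)
        show "0 < r / 2" using r by (simp add: good_def)
        fix g assume g: "test_function g \<and> (\<forall>z. r / 2 \<le> dist z y \<longrightarrow> g z = 0)"
        have "g z = 0" if "r \<le> dist z x" for z
          using g y that dist_triangle[of z x y] by (auto simp: not_le[symmetric])
        then show "\<phi> o\<^sub>L localize basepoint g \<in> Z" using r g by (auto simp: good_def)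
      qed
      then show "\<exists>e>0. \<forall>y. dist y x < e \<longrightarrow> y \<in> - B"
        using r by (intro exI[of _ "r / 2"]) (auto simp: B_def good_def[of x])
    qed
    then have "closed B" by (simp add: closed_def)
    have complete: "complete (UNIV :: 'a set)"
      unfolding complete_def
    proof (intro allI impI)
      fix f :: "nat \<Rightarrow> 'a" assume f: "(\<forall>n. f n \<in> UNIV) \<and> Cauchy f"
      then have "bounded (range f)" by (simp add: cauchy_imp_bounded)
      then obtain c R where "range f \<subseteq> cball c R" unfolding bounded_def by (auto simp: subset_iff)
      then show "\<exists>l\<in>UNIV. f \<longlonglongrightarrow> l"
        using compact_imp_complete[OF proper[of c R]] f unfolding complete_def by blast
    qed
    obtain x where x: "x \<in> B" "\<not> x islimpt B"
      by (rule countable_closed_has_isolated_point[OF complete \<open>closed B\<close>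
          countable_subset[OF subset_UNIV countable] \<open>B \<noteq> {}\<close>])
    from x(2) obtain r where r: "0 < r" "\<And>y. y \<in> B \<Longrightarrow> dist y x < r \<Longrightarrow> y = x"
      unfolding islimpt_approachable by metis
    obtain \<delta> where \<delta>: "\<delta> \<in> derivations x" "(\<lambda>n. \<phi> o\<^sub>L localize x (bump x ((1 / 2) ^ n))) \<longlonglongrightarrow> \<delta>"
      by (rule derivation_part)
    \<comment> \<open>Half of r, because isolation of x in B is known on the open ball of radius r
      and the closed ball used below must fit inside it.\<close>
    have "good x (r / 2)"
      unfolding good_def
    proof (intro conjI allI impI)
      show "0 < r / 2" using r by simp
      fix g assume g: "test_function g \<and> (\<forall>y. r / 2 \<le> dist y x \<longrightarrow> g y = 0)"
      define c where "c n = bump x ((1 / 2) ^ n)" for n :: nat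
      define L where "L = (\<phi> o\<^sub>L localize x g)"
      \<comment> \<open>The weight g * (1 - c n) lives on a closed ball with a small open ball
        around x removed. This set is compact and misses B, so the part of L above the scale of
        \<open>c n\<close> already lies in Z.\<close>
      have part: "L - (\<phi> o\<^sub>L localize x (c n) o\<^sub>L localize x g) \<in> Z" for n
      proof -
        let ?s = "(1 / 2 :: real) ^ n"
        let ?g1 = "\<lambda>y. g y * c n y" and ?g2 = "\<lambda>y. g y * (1 - c n y)"
        have s: "0 < ?s" by simp
        have test: "test_function ?g1" "test_function ?g2"
          unfolding c_def
          by (rule test_function_mult[OF conjunct1[OF g] lipschitz_bump[OF s] abs_bump_le(1)])
            (rule test_function_mult[OF conjunct1[OF g] lipschitz_one_minus_bump[OF s] abs_bump_le(2)])
        have eq: "(\<lambda>y. ?g1 y + ?g2 y) = g" by (auto simp: algebra_simps)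
        have "localize x g = localize x ?g1 + localize x ?g2"
          using localize_add[OF test, of x] g by (simp only: eq)
        moreover have "localize x (c n) o\<^sub>L localize x g = localize x ?g1"
          using g test by (intro localize_comp) (auto simp: c_def test_function_bump)
        moreover have "\<phi> o\<^sub>L localize x (c n) o\<^sub>L localize x g = \<phi> o\<^sub>L (localize x (c n) o\<^sub>L localize x g)"
          by (rule blinfun_eqI) simp
        ultimately have "L - (\<phi> o\<^sub>L localize x (c n) o\<^sub>L localize x g) = \<phi> o\<^sub>L localize x ?g2"
          by (simp add: L_def bounded_bilinear.add_right[OF bounded_bilinear_blinfun_compose])
        also have "\<dots> \<in> Z"
        proof (subst base[symmetric, OF test(2)], rule compact_good[OF _ _ test(2)])
          let ?K = "cball x (r / 2) - ball x ?s"
          show "compact ?K" by (intro compact_diff proper) simp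
          show "?K \<inter> B = {}" 
          proof (rule ccontr)
            assume "?K \<inter> B \<noteq> {}"
            then obtain y where y: "y \<in> B" "dist x y \<le> r / 2" "\<not> dist x y < ?s" by auto
            then have "y = x" using r by (intro r(2)) (auto simp: dist_commute)
            then show False using y(3) s by simp
          qed
          show "?g2 y = 0" if "y \<notin> ?K" for y
          proof (cases "dist y x < ?s")
            case True
            then show ?thesis using bump_eq_1[OF s, of y x] by (simp add: c_def)
          next
            case False
            then show ?thesis using that g by (auto simp: dist_commute)
          qed
        qed
        finally show ?thesis .
      qed
      have "(\<lambda>n. L - (\<phi> o\<^sub>L localize x (c n) o\<^sub>L localize x g)) \<longlonglongrightarrow> L - (\<delta> o\<^sub>L localize x g)"
        unfolding c_def
        by (intro tendsto_diff tendsto_const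
            bounded_bilinear.tendsto[OF bounded_bilinear_blinfun_compose \<delta>(2) tendsto_const])
      from closed_sequentially[OF Z(2) part this] have "L - (\<delta> o\<^sub>L localize x g) \<in> Z" .
      moreover have "\<delta> o\<^sub>L localize x g \<in> Z"
        using derivation_localize[OF \<delta>(1)] g deriv by blast
      ultimately have "L \<in> Z" using subspace_add[OF Z(1)] by fastforce
      then show "\<phi> o\<^sub>L localize basepoint g \<in> Z" using base[of g x] g by (simp add: L_def)
    qed
    then show False using x(1) by (auto simp: B_def)
  qed
  have cutoff: "\<phi> o\<^sub>L cutoff_op n \<in> Z" for n
    unfolding cutoff_op_eq_localize
  proof (rule compact_good[OF proper[of basepoint "2 * 2 powi n"]])
    show "bump basepoint (2 powi n) y = 0" if "y \<notin> cball basepoint (2 * 2 powi n)" for y :: 'a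
      using that by (intro bump_eq_0) (auto simp: dist_commute)
  qed (use \<open>B = {}\<close> in \<open>auto simp: test_function_bump\<close>)
  obtain \<psi> where \<psi>: "\<phi> - \<psi> \<in> concentrated_at_infinity" "(\<lambda>n. \<phi> o\<^sub>L cutoff_op (int n)) \<longlonglongrightarrow> \<psi>"
    by (rule part_at_infinity)
  have "\<psi> \<in> Z" using closed_sequentially[OF Z(2) _ \<psi>(2)] cutoff by blast
  moreover have "\<phi> - \<psi> \<in> Z" using \<psi>(1) inf by blast
  ultimately show ?thesis using subspace_add[OF Z(1)] by fastforce
qed

section \<open>The summands as annihilators, and assembly of the sum\<close>

lemma closed_kernel: "closed {\<phi> :: 'b::real_normed_vector \<Rightarrow>\<^sub>L real. \<forall>f\<in>A. blinfun_apply \<phi> f = 0}"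
proof -
  have "closed (\<Inter>f\<in>A. {\<phi> :: 'b \<Rightarrow>\<^sub>L real. blinfun_apply \<phi> f = 0})"
    by (intro closed_INT ballI closed_Collect_eq continuous_intros)
  then show ?thesis by (simp add: INTER_eq)
qed

lemma subspace_kernel: "subspace {\<phi> :: 'b::real_normed_vector \<Rightarrow>\<^sub>L real. \<forall>f\<in>A. blinfun_apply \<phi> f = 0}"
  by (auto simp: subspace_def blinfun.zero_left blinfun.add_left blinfun.scaleR_left)

text \<open>Annihilators of sets of functions are closed subspaces, so this form settles both
  structural conditions at once.\<close>

lemma derivations_eq_kernel:
  "derivations x = {\<phi>. \<forall>f \<in> {f. \<exists>c. \<forall>\<^sub>F y in nhds x. lip0_apply f y = c}. blinfun_apply \<phi> f = 0}"
  by (auto simp: derivations_def derivation_at_def)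

lemma concentrated_at_infinity_eq_kernel:
  "concentrated_at_infinity = {\<phi>. \<forall>f \<in> (\<Union>n. range (cutoff_op n)). blinfun_apply \<phi> f = 0}"
  by (auto simp: concentrated_at_infinity_def blinfun.zero_left intro!: blinfun_eqI dest!: arg_cong[where f = blinfun_apply] fun_cong)

text \<open>At an isolated point every function is locally constant. This reconciles the index set
  of accumulation points with the density argument, which asks for the derivations at every
  point.\<close>

lemma derivations_isolated:
  assumes "\<not> x islimpt UNIV" and \<phi>: "\<phi> \<in> derivations x"
  shows "\<phi> = 0"
proof (rule blinfun_eqI)
  fix f
  obtain r where "r > 0" "\<And>y. dist y x < r \<Longrightarrow> y = x"
    using assms(1) unfolding islimpt_approachable by blast
  then have "\<forall>\<^sub>F y in nhds x. lip0_apply f y = lip0_apply f x"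
    unfolding eventually_nhds_metric by metis
  then show "blinfun_apply \<phi> f = blinfun_apply 0 f"
    using \<phi> unfolding derivations_def derivation_at_def by (auto simp: blinfun.zero_left)
qed

lemma subspace_summand_space: "subspace (summand_space i)"
proof (cases i)
  case Free
  then show ?thesis by (simp add: free_space_def subspace_closure)
qed (simp_all only: summand_space.simps derivations_eq_kernel concentrated_at_infinity_eq_kernel subspace_kernel)

lemma closed_summand_space: "closed (summand_space i)"
proof (cases i)
  case Free
  then show ?thesis by (simp add: free_space_def)
qed (simp_all only: summand_space.simps derivations_eq_kernel concentrated_at_infinity_eq_kernel closed_kernel)

lemma norm_sum_summand_space:
  fixes u :: "'a::pointed_metric_space summand \<Rightarrow> 'a lip0_dual"
  assumes F: "finite F" and u: "\<And>i. i \<in> F \<Longrightarrow> u i \<in> summand_space i"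
  shows "norm (\<Sum>i\<in>F. u i) = (\<Sum>i\<in>F. norm (u i))"
proof -
  \<comment> \<open>Padding by zero makes the components at \<open>Free\<close> and
    \<open>Infinity\<close> available even when F omits them.\<close>
  define v where "v i = (if i \<in> F then u i else 0)" for i
  define P where "P = {x. Deriv x \<in> F}"
  have v: "v i \<in> summand_space i" for i
    using u by (simp add: v_def subspace_0[OF subspace_summand_space])
  have P: "finite P"
    unfolding P_def using finite_vimageI[OF F, of Deriv] by (simp add: inj_def vimage_def)
  have F_sub: "F \<subseteq> {Free, Infinity} \<union> Deriv ` P"
  proof
    fix i assume "i \<in> F"
    then show "i \<in> {Free, Infinity} \<union> Deriv ` P" by (cases i) (auto simp: P_def)
  qed
  \<comment> \<open>Stated for any h with h 0 = 0 so that one regrouping serves both the vectors,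
    with h the identity, and their norms.\<close>
  have split: "(\<Sum>i\<in>F. h (u i)) = h (v Free) + h (v Infinity) + (\<Sum>x\<in>P. h (v (Deriv x)))"
    if "h 0 = 0" for h :: "'a lip0_dual \<Rightarrow> 'c::real_vector"
  proof -
    have "(\<Sum>i\<in>F. h (u i)) = (\<Sum>i\<in>{Free, Infinity} \<union> Deriv ` P. h (v i))"
      using F_sub P that by (intro sum.mono_neutral_cong_left) (auto simp: v_def)
    also have "\<dots> = (\<Sum>i\<in>{Free, Infinity}. h (v i)) + (\<Sum>i\<in>Deriv ` P. h (v i))"
      using P by (intro sum.union_disjoint) auto
    also have "\<dots> = h (v Free) + h (v Infinity) + (\<Sum>x\<in>P. h (v (Deriv x)))"
      by (simp add: sum.reindex inj_on_def)
    finally show ?thesis .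
  qed
  show ?thesis
    using norm_sum_components[of "v Free" "v Infinity" P "\<lambda>x. v (Deriv x)"]
      v[of Free] v[of Infinity] v[of "Deriv _"] P split[of "\<lambda>\<phi>. \<phi>"] split[of norm] by simp
qed

theorem proposition6p7:
  assumes countable: "countable (UNIV :: 'a::pointed_metric_space set)"
    and proper: "\<And>(x :: 'a) r. compact (cball x r)"
  shows "internal_l1_sum
    ({Free, Infinity} \<union> Deriv ` {x :: 'a. x islimpt UNIV})
    (summand_space :: 'a summand \<Rightarrow> 'a lip0_dual set)"
proof (rule internal_l1_sumI)
  let ?I = "{Free, Infinity} \<union> Deriv ` {x :: 'a. x islimpt UNIV}"
  let ?Z = "closure (span (\<Union>i\<in>?I. summand_space i))"
  have summand: "summand_space i \<subseteq> ?Z" if "i \<in> ?I" for i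
    using that span_superset closure_subset by fastforce
  show "?Z = UNIV"
  proof (rule UNIV_eq_I[symmetric])
    fix \<phi>
    show "\<phi> \<in> ?Z"
    proof (rule decomposition_dense[OF countable proper])
      show "subspace ?Z" by (intro subspace_closure subspace_span)
      show "closed ?Z" by simp
      show "eval_functional x \<in> ?Z" for x
      proof -
        have "eval_functional x \<in> free_space"
          unfolding free_space_def using span_superset closure_subset by fastforce
        then show ?thesis using summand[of Free] by auto
      qed
      show "derivations x \<subseteq> ?Z" for x
      proof (cases "x islimpt UNIV")
        case True
        then show ?thesis using summand[of "Deriv x"] by simp
      next
        case False
        then show ?thesis
          using derivations_isolated subspace_0[OF subspace_closure[OF subspace_span]] by blast
      qed
      show "concentrated_at_infinity \<subseteq> ?Z" using summand[of Infinity] by simp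
    qed
  qed
qed (simp_all add: subspace_summand_space closed_summand_space norm_sum_summand_space)

end
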